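(* (1) Let $X$ be a topological space and $x_0\in X$. If the natural homomorphism $\varphi:\pi_1(X,x_0)\rightarrow\check{\pi}_1(X,x_0)$ from the fundamental group to the first shape homotopy group is injective, then $X$ is homotopically Hausdorff at $x_0$. (2) The converse need not hold: there exist a topological space $X$ and a point $x_0\in X$ such that $X$ is homotopically Hausdorff at $x_0$, but $\varphi:\pi_1(X,x_0)\rightarrow\check{\pi}_1(X,x_0)$ is not injective.
   Context: A space $X$ is homotopically Hausdorff at the point $x_0\in X$ if for every $g\in\pi_1(X,x_0)\setminus\{1\}$ there is an open set $U\subseteq X$ with $x_0\in U$ such that there is no loop $\alpha:(S^1,\ast)\to(U,x_0)$ with $[\alpha]=g$ in $\pi_1(X,x_0)$. First shape homotopy group. Let $(X,x_0)$ be a pointed topological space. Let $\mathcal C$ be the collection of all pairs $(\mathcal U,\ast)$, where $\mathcal U$ is a normal open cover of $X$ (an open cover admitting a subordinated partition of unity; for separable metric $X$ one may equivalently use locally finite open covers) and $\ast\in\mathcal U$ is a designated member with $x_0\in\ast$; $\mathcal C$ is directed by refinement (with the designated member refining the designated member). Let $(N(\mathcal U),\ast)$ be a geometric realization of the nerve of $\mathcal U$, i.e. of the abstract simplicial complex of nonempty finite $\Delta\subseteq\mathcal U$ with $\bigcap_{U\in\Delta}U\neq\emptyset$, with distinguished vertex $\ast$. Whenever $(\mathcal V,\ast)$ refines $(\mathcal U,\ast)$, choose a pointed simplicial map $p_{\mathcal U\mathcal V}:(N(\mathcal V),\ast)\to(N(\mathcal U),\ast)$ sending the vertex of each $V\in\mathcal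 V$ to the vertex of some $U\in\mathcal U$ with $V\subseteq U$; it is unique up to pointed homotopy. For each $(\mathcal U,\ast)\in\mathcal C$ choose a pointed map $p_{\mathcal U}:(X,x_0)\to(N(\mathcal U),\ast)$ with $p_{\mathcal U}^{-1}(St(U,N(\mathcal U)))\subseteq U$ for all $U\in\mathcal U$, where $St(U,N(\mathcal U))$ is the open star of the vertex corresponding to $U$; it is unique up to pointed homotopy, and $p_{\mathcal U\mathcal V}\circ p_{\mathcal V}$ is pointed homotopic to $p_{\mathcal U}$. The first shape homotopy group is $$\check{\pi}_1(X,x_0)=\varprojlim\,(\pi_1(N(\mathcal U),\ast),\,p_{\mathcal U\mathcal V\#},\,\mathcal C),$$ and the natural homomorphism is $\varphi([\alpha])=([p_{\mathcal U}\circ\alpha])_{(\mathcal U,\ast)\in\mathcal C}$. *)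

theory Defs
  imports "HOL-Analysis.Analysis" "HOL-Algebra.Product_Groups"
begin

section \<open>The fundamental group of a pointed space\<close>

text \<open>Loops are maps on the unit interval; their values outside the interval are irrelevant,
  and functions agreeing on it are homotopic in the sense used here.\<close>

definition loops_at :: "'a topology \<Rightarrow> 'a \<Rightarrow> (real \<Rightarrow> 'a) set"
  where "loops_at X x0 = {\<alpha>. pathin X \<alpha> \<and> \<alpha> 0 = x0 \<and> \<alpha> 1 = x0}"

definition loop_homotopic :: "'a topology \<Rightarrow> 'a \<Rightarrow> (real \<Rightarrow> 'a) \<Rightarrow> (real \<Rightarrow> 'a) \<Rightarrow> bool"
  where "loop_homotopic X x0 =
    homotopic_with (\<lambda>\<gamma>. \<gamma> 0 = x0 \<and> \<gamma> 1 = x0) (top_of_set {0..1}) X"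

definition loop_class :: "'a topology \<Rightarrow> 'a \<Rightarrow> (real \<Rightarrow> 'a) \<Rightarrow> (real \<Rightarrow> 'a) set"
  where "loop_class X x0 \<alpha> = {\<beta>. loop_homotopic X x0 \<alpha> \<beta>}"

definition loop_concat :: "(real \<Rightarrow> 'a) \<Rightarrow> (real \<Rightarrow> 'a) \<Rightarrow> real \<Rightarrow> 'a"
  where "loop_concat \<alpha> \<beta> = (\<lambda>t. if t \<le> 1/2 then \<alpha> (2 * t) else \<beta> (2 * t - 1))"

definition pi1 :: "'a topology \<Rightarrow> 'a \<Rightarrow> (real \<Rightarrow> 'a) set monoid"
  where "pi1 X x0 =
    \<lparr>carrier = loop_class X x0 ` loops_at X x0,
     monoid.mult = (\<lambda>A B. \<Union>\<alpha>\<in>A. \<Union>\<beta>\<in>B. loop_class X x0 (loop_concat \<alpha> \<beta>)),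
     one = loop_class X x0 (\<lambda>t. x0)\<rparr>"

text \<open>The homomorphism induced by a pointed map \<open>f\<close> into \<open>(Y, y0)\<close>: all classes in the union
  coincide, so its value at the class of \<open>\<alpha>\<close> is the class of \<open>f \<circ> \<alpha>\<close>
  (lemma \<open>pi1_map_loop_class\<close> below).\<close>

definition pi1_map :: "'b topology \<Rightarrow> 'b \<Rightarrow> ('a \<Rightarrow> 'b) \<Rightarrow> (real \<Rightarrow> 'a) set \<Rightarrow> (real \<Rightarrow> 'b) set"
  where "pi1_map Y y0 f A = (\<Union>\<alpha>\<in>A. loop_class Y y0 (f \<circ> \<alpha>))"

definition homotopically_Hausdorff_at :: "'a topology \<Rightarrow> 'a \<Rightarrow> bool"
  where "homotopically_Hausdorff_at X x0 \<longleftrightarrow>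
    (\<forall>g \<in> carrier (pi1 X x0) - {\<one>\<^bsub>pi1 X x0\<^esub>}.
       \<exists>U. openin X U \<and> x0 \<in> U \<and>
           \<not> (\<exists>\<alpha> \<in> loops_at (subtopology X U) x0. loop_class X x0 \<alpha> = g))"


section \<open>Geometric realizations and nerves\<close>

text \<open>Points of the realization of an abstract simplicial complex \<open>K\<close> (a family of finite
  nonempty sets of vertices) are given by their barycentric coordinates. The realization carries
  the weak (CW) topology: a set is open iff its trace on every closed simplex is open in the
  Euclidean topology of that simplex.\<close>

definition closed_simplex :: "'v set \<Rightarrow> ('v \<Rightarrow> real) set"
  where "closed_simplex s = {b. (\<forall>v. 0 \<le> b v) \<and> (\<forall>v. v \<notin> s \<longrightarrow> b v = 0) \<and> sum b s = 1}"

definition realization :: "'v set set \<Rightarrow> ('v \<Rightarrow> real) topology"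
  where "realization K = topology (\<lambda>W. W \<subseteq> \<Union> (closed_simplex ` K) \<and>
    (\<forall>s\<in>K. openin (subtopology (powertop_real UNIV) (closed_simplex s)) (W \<inter> closed_simplex s)))"

definition vertex :: "'v \<Rightarrow> 'v \<Rightarrow> real"
  where "vertex v = (\<lambda>w. if w = v then 1 else 0)"

definition open_star :: "'v set set \<Rightarrow> 'v \<Rightarrow> ('v \<Rightarrow> real) set"
  where "open_star K v = {b \<in> \<Union> (closed_simplex ` K). b v > 0}"

text \<open>The affine extension of a map of vertices.\<close>

definition simplicial_map :: "('v \<Rightarrow> 'w) \<Rightarrow> ('v \<Rightarrow> real) \<Rightarrow> 'w \<Rightarrow> real"
  where "simplicial_map q b = (\<lambda>w. \<Sum>v | b v \<noteq> 0 \<and> q v = w. b v)"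

definition nerve :: "'a set set \<Rightarrow> 'a set set set"
  where "nerve \<U> = {\<Delta>. \<Delta> \<noteq> {} \<and> finite \<Delta> \<and> \<Delta> \<subseteq> \<U> \<and> \<Inter>\<Delta> \<noteq> {}}"


section \<open>Pointed normal covers\<close>

definition open_cover_of :: "'a topology \<Rightarrow> 'a set set \<Rightarrow> bool"
  where "open_cover_of X \<U> \<longleftrightarrow> (\<forall>U\<in>\<U>. openin X U) \<and> \<Union>\<U> = topspace X"

text \<open>A locally finite partition of unity indexed by the members of \<open>\<U>\<close>, each function being
  nonzero only inside the corresponding member.\<close>

definition subordinated_partition_of_unity ::
    "'a topology \<Rightarrow> 'a set set \<Rightarrow> ('a set \<Rightarrow> 'a \<Rightarrow> real) \<Rightarrow> bool"
  where "subordinated_partition_of_unity X \<U> f \<longleftrightarrow>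
    (\<forall>U\<in>\<U>. continuous_map X (top_of_set {0..1}) (f U)) \<and>
    (\<forall>U\<in>\<U>. {x \<in> topspace X. f U x \<noteq> 0} \<subseteq> U) \<and>
    (\<forall>x \<in> topspace X. \<exists>W. openin X W \<and> x \<in> W \<and> finite {U\<in>\<U>. \<exists>y\<in>W. f U y \<noteq> 0}) \<and>
    (\<forall>x \<in> topspace X. (\<Sum>U | U \<in> \<U> \<and> f U x \<noteq> 0. f U x) = 1)"

definition normal_open_cover :: "'a topology \<Rightarrow> 'a set set \<Rightarrow> bool"
  where "normal_open_cover X \<U> \<longleftrightarrow>
    open_cover_of X \<U> \<and> (\<exists>f. subordinated_partition_of_unity X \<U> f)"

type_synonym 'a pointed_cover = "'a set set \<times> 'a set"

definition pointed_covers :: "'a topology \<Rightarrow> 'a \<Rightarrow> 'a pointed_cover set"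
  where "pointed_covers X x0 = {(\<U>, U0). normal_open_cover X \<U> \<and> U0 \<in> \<U> \<and> x0 \<in> U0}"

definition refines :: "'a pointed_cover \<Rightarrow> 'a pointed_cover \<Rightarrow> bool"
  where "refines \<V> \<U> \<longleftrightarrow> (\<forall>V \<in> fst \<V>. \<exists>U \<in> fst \<U>. V \<subseteq> U) \<and> snd \<V> \<subseteq> snd \<U>"

abbreviation nerve_space :: "'a pointed_cover \<Rightarrow> ('a set \<Rightarrow> real) topology"
  where "nerve_space \<U> \<equiv> realization (nerve (fst \<U>))"

abbreviation nerve_base :: "'a pointed_cover \<Rightarrow> 'a set \<Rightarrow> real"
  where "nerve_base \<U> \<equiv> vertex (snd \<U>)"

abbreviation pi1_nerve :: "'a pointed_cover \<Rightarrow> (real \<Rightarrow> 'a set \<Rightarrow> real) set monoid"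
  where "pi1_nerve \<U> \<equiv> pi1 (nerve_space \<U>) (nerve_base \<U>)"


section \<open>The first shape homotopy group\<close>

text \<open>\<open>bonding_vertex_map \<V> \<U> q\<close>: the vertex map \<open>q\<close> induces a choice of \<open>p\<^bsub>\<U>\<V>\<^esub>\<close>.\<close>

definition bonding_vertex_map ::
    "'a pointed_cover \<Rightarrow> 'a pointed_cover \<Rightarrow> ('a set \<Rightarrow> 'a set) \<Rightarrow> bool"
  where "bonding_vertex_map \<V> \<U> q \<longleftrightarrow>
    q (snd \<V>) = snd \<U> \<and> (\<forall>V \<in> fst \<V>. q V \<in> fst \<U> \<and> V \<subseteq> q V)"

definition canonical_map ::
    "'a topology \<Rightarrow> 'a \<Rightarrow> 'a pointed_cover \<Rightarrow> ('a \<Rightarrow> 'a set \<Rightarrow> real) \<Rightarrow> bool"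
  where "canonical_map X x0 \<U> p \<longleftrightarrow>
    continuous_map X (nerve_space \<U>) p \<and> p x0 = nerve_base \<U> \<and>
    (\<forall>U \<in> fst \<U>. {x \<in> topspace X. p x \<in> open_star (nerve (fst \<U>)) U} \<subseteq> U)"

text \<open>The choices entering the definition of the shape group and of the natural homomorphism:
  maps \<open>p \<U>\<close> into the nerves and vertex maps \<open>q \<U> \<V>\<close> for \<open>\<V>\<close> refining \<open>\<U>\<close>.\<close>

definition shape_choice ::
    "'a topology \<Rightarrow> 'a \<Rightarrow> ('a pointed_cover \<Rightarrow> 'a \<Rightarrow> 'a set \<Rightarrow> real) \<Rightarrow>
     ('a pointed_cover \<Rightarrow> 'a pointed_cover \<Rightarrow> 'a set \<Rightarrow> 'a set) \<Rightarrow> bool"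
  where "shape_choice X x0 p q \<longleftrightarrow>
    (\<forall>\<U> \<in> pointed_covers X x0. canonical_map X x0 \<U> (p \<U>)) \<and>
    (\<forall>\<U> \<in> pointed_covers X x0. \<forall>\<V> \<in> pointed_covers X x0.
       refines \<V> \<U> \<longrightarrow> bonding_vertex_map \<V> \<U> (q \<U> \<V>))"

definition shape_group ::
    "'a topology \<Rightarrow> 'a \<Rightarrow> ('a pointed_cover \<Rightarrow> 'a pointed_cover \<Rightarrow> 'a set \<Rightarrow> 'a set) \<Rightarrow>
     ('a pointed_cover \<Rightarrow> (real \<Rightarrow> 'a set \<Rightarrow> real) set) monoid"
  where "shape_group X x0 q =
    (product_group (pointed_covers X x0) pi1_nerve)
      \<lparr>carrier := {g \<in> (\<Pi>\<^sub>E \<U> \<in> pointed_covers X x0. carrier (pi1_nerve \<U>)).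
         \<forall>\<U> \<in> pointed_covers X x0. \<forall>\<V> \<in> pointed_covers X x0. refines \<V> \<U> \<longrightarrow>
           pi1_map (nerve_space \<U>) (nerve_base \<U>) (simplicial_map (q \<U> \<V>)) (g \<V>) = g \<U>}\<rparr>"

definition natural_hom ::
    "'a topology \<Rightarrow> 'a \<Rightarrow> ('a pointed_cover \<Rightarrow> 'a \<Rightarrow> 'a set \<Rightarrow> real) \<Rightarrow>
     (real \<Rightarrow> 'a) set \<Rightarrow> 'a pointed_cover \<Rightarrow> (real \<Rightarrow> 'a set \<Rightarrow> real) set"
  where "natural_hom X x0 p g =
    (\<lambda>\<U> \<in> pointed_covers X x0. pi1_map (nerve_space \<U>) (nerve_base \<U>) (p \<U>) g)"


section \<open>The definitions are consistent\<close>

subsection \<open>The topology of a realization\<close>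

lemma openin_realization:
  "openin (realization K) W \<longleftrightarrow> W \<subseteq> \<Union> (closed_simplex ` K) \<and>
    (\<forall>s\<in>K. openin (subtopology (powertop_real UNIV) (closed_simplex s)) (W \<inter> closed_simplex s))"
proof -
  have "istopology (\<lambda>W. W \<subseteq> \<Union> (closed_simplex ` K) \<and>
    (\<forall>s\<in>K. openin (subtopology (powertop_real UNIV) (closed_simplex s)) (W \<inter> closed_simplex s)))"
    (is "istopology ?P")
    unfolding istopology_def
  proof (intro conjI allI impI)
    fix S T assume "?P S" "?P T"
    moreover have "(S \<inter> T) \<inter> closed_simplex s = (S \<inter> closed_simplex s) \<inter> (T \<inter> closed_simplex s)" for s
      by blast
    ultimately show "S \<inter> T \<subseteq> \<Union> (closed_simplex ` K)"
      "\<forall>s\<in>K. openin (subtopology (powertop_real UNIV) (closed_simplex s)) (S \<inter> T \<inter> closed_simplex s)"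
      by (auto intro: openin_Int)
  next
    fix \<K> assume *: "\<forall>S\<in>\<K>. ?P S"
    then show "\<Union>\<K> \<subseteq> \<Union> (closed_simplex ` K)" by blast
    show "\<forall>s\<in>K. openin (subtopology (powertop_real UNIV) (closed_simplex s)) (\<Union>\<K> \<inter> closed_simplex s)"
    proof
      fix s assume "s \<in> K"
      have eq: "\<Union>\<K> \<inter> closed_simplex s = (\<Union>S\<in>\<K>. S \<inter> closed_simplex s)" by blast
      show "openin (subtopology (powertop_real UNIV) (closed_simplex s)) (\<Union>\<K> \<inter> closed_simplex s)"
        unfolding eq by (rule openin_Union) (use * \<open>s \<in> K\<close> in blast)
    qed
  qed
  then show ?thesis by (simp add: realization_def topology_inverse')
qed

lemma topspace_realization: "topspace (realization K) = \<Union> (closed_simplex ` K)"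
proof
  show "topspace (realization K) \<subseteq> \<Union> (closed_simplex ` K)"
    by (metis openin_realization openin_topspace)
  have "openin (realization K) (\<Union> (closed_simplex ` K))"
    unfolding openin_realization
  proof (intro conjI ballI)
    fix s assume "s \<in> K"
    then have "\<Union> (closed_simplex ` K) \<inter> closed_simplex s = closed_simplex s" by blast
    then show "openin (subtopology (powertop_real UNIV) (closed_simplex s)) (\<Union> (closed_simplex ` K) \<inter> closed_simplex s)"
      by (simp add: openin_subtopology_refl)
  qed simp
  then show "\<Union> (closed_simplex ` K) \<subseteq> topspace (realization K)" by (rule openin_subset)
qed

lemma closedin_realization:
  "closedin (realization K) C \<longleftrightarrow> C \<subseteq> \<Union> (closed_simplex ` K) \<and>
    (\<forall>s\<in>K. closedin (subtopology (powertop_real UNIV) (closed_simplex s)) (C \<inter> closed_simplex s))"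
proof -
  have ts: "topspace (subtopology (powertop_real UNIV) (closed_simplex s)) = closed_simplex s" for s :: "'a set"
    by (simp)
  have "closed_simplex s - C \<inter> closed_simplex s = (\<Union> (closed_simplex ` K) - C) \<inter> closed_simplex s"
    if "s \<in> K" for s using that by blast
  then show ?thesis
    unfolding closedin_def topspace_realization openin_realization ts
    by auto
qed

lemma closedin_closed_simplex:
  assumes "finite s"
  shows "closedin (powertop_real UNIV) (closed_simplex s)"
proof -
  have 1: "closedin (powertop_real UNIV) {b. 0 \<le> b v}" for v :: 'a
    using closedin_continuous_map_preimage[of "powertop_real UNIV" euclideanreal "\<lambda>b. b v" "{0..}"]
    by (auto intro: continuous_map_product_projection)
  have 2: "closedin (powertop_real UNIV) {b. b v = 0}" for v :: 'a
    using closedin_continuous_map_preimage[of "powertop_real UNIV" euclideanreal "\<lambda>b. b v" "{0}"]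
    by (auto intro: continuous_map_product_projection)
  have "continuous_map (powertop_real UNIV) euclideanreal (\<lambda>b. sum b s)"
    by (intro continuous_map_sum assms continuous_map_product_projection) auto
  from closedin_continuous_map_preimage[OF this, of "{1}"]
  have 3: "closedin (powertop_real UNIV) {b. sum b s = 1}" by auto
  have "closed_simplex s = (\<Inter>v. {b. 0 \<le> b v}) \<inter> (\<Inter>v. if v \<in> s then UNIV else {b. b v = 0}) \<inter> {b. sum b s = 1}"
    by (auto simp: closed_simplex_def split: if_splits)
  moreover have "closedin (powertop_real UNIV) (if v \<in> s then UNIV else {b. b v = 0})" for v
    using 2[of v] closedin_topspace[of "powertop_real UNIV"] by auto
  ultimately show ?thesis
    by (simp only:) (intro closedin_Int closedin_INT 1 3; auto)
qed

lemma closedin_realization_finite: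
  assumes "\<And>s. s \<in> K \<Longrightarrow> finite s"
  shows "closedin (realization K) C \<longleftrightarrow> C \<subseteq> \<Union> (closed_simplex ` K) \<and>
    (\<forall>s\<in>K. closedin (powertop_real UNIV) (C \<inter> closed_simplex s))"
proof -
  have "closedin (subtopology (powertop_real UNIV) (closed_simplex s)) (C \<inter> closed_simplex s)
     \<longleftrightarrow> closedin (powertop_real UNIV) (C \<inter> closed_simplex s)" if "s \<in> K" for s
    using closedin_closed_simplex[OF assms[OF that]]
    by (metis closedin_closed_subtopology inf_le2)
  then show ?thesis unfolding closedin_realization by auto
qed

text \<open>A map into the realization is continuous once it is continuous for the product topology
  and takes values in finitely many closed simplices.\<close>

lemma continuous_map_into_realization:
  assumes fin: "\<And>s. s \<in> K \<Longrightarrow> finite s"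
    and F: "finite F" "F \<subseteq> K"
    and f: "continuous_map Z (powertop_real UNIV) f"
    and im: "\<And>z. z \<in> topspace Z \<Longrightarrow> \<exists>s\<in>F. f z \<in> closed_simplex s"
  shows "continuous_map Z (realization K) f"
  unfolding continuous_map_closedin
proof (intro conjI allI impI)
  show "f \<in> topspace Z \<rightarrow> topspace (realization K)"
    using im F by (fastforce simp: topspace_realization)
  fix C assume "closedin (realization K) C"
  then have C: "closedin (powertop_real UNIV) (C \<inter> closed_simplex s)" if "s \<in> F" for s
    using closedin_realization_finite[OF fin] F that by blast
  have "{z \<in> topspace Z. f z \<in> C} = (\<Union>s\<in>F. {z \<in> topspace Z. f z \<in> C \<inter> closed_simplex s})"
    using im by blast
  also have "closedin Z \<dots>"
    using closedin_continuous_map_preimage[OF f C] F(1)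
    by (intro closedin_Union) blast+
  finally show "closedin Z {z \<in> topspace Z. f z \<in> C}" .
qed

lemma closed_simplex_support:
  assumes "finite s" "b \<in> closed_simplex s" "{v. b v \<noteq> 0} \<subseteq> t" "finite t"
  shows "b \<in> closed_simplex t"
proof -
  have "{v. b v \<noteq> 0} \<subseteq> s" using assms(2) by (auto simp: closed_simplex_def)
  then have "sum b s = sum b {v. b v \<noteq> 0}"
    by (intro sum.mono_neutral_right assms(1)) auto
  moreover have "sum b t = sum b {v. b v \<noteq> 0}"
    by (intro sum.mono_neutral_right assms(3,4)) auto
  ultimately show ?thesis using assms(2,3) by (auto simp: closed_simplex_def)
qed

lemma closed_simplex_support_nonempty:
  assumes "b \<in> closed_simplex s" shows "{v. b v \<noteq> 0} \<noteq> {}"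
proof
  assume "{v. b v \<noteq> 0} = {}"
  then have "sum b s = 0" by (intro sum.neutral) blast
  then show False using assms by (simp add: closed_simplex_def)
qed

lemma finite_supports_of_compact:
  assumes fin: "\<And>s. s \<in> K \<Longrightarrow> finite s" and Q: "compactin (realization K) Q"
  shows "finite ((\<lambda>b. {v. b v \<noteq> (0::real)}) ` Q)"
proof -
  let ?supp = "\<lambda>b::'a \<Rightarrow> real. {v. b v \<noteq> 0}"
  obtain P where P: "P \<subseteq> Q" "inj_on ?supp P" "?supp ` P = ?supp ` Q"
    using subset_image_inj[of "?supp ` Q" ?supp Q] by auto
  have Qs: "Q \<subseteq> \<Union> (closed_simplex ` K)"
    using compactin_subset_topspace[OF Q] by (simp add: topspace_realization)
  have cr: "closedin (realization K) C \<longleftrightarrow> C \<subseteq> \<Union> (closed_simplex ` K) \<and>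
    (\<forall>s\<in>K. closedin (powertop_real UNIV) (C \<inter> closed_simplex s))" for C
    by (rule closedin_realization_finite) (rule fin)
  have cl: "closedin (realization K) A" if "A \<subseteq> P" for A
    unfolding cr
  proof (intro conjI ballI)
    show "A \<subseteq> \<Union> (closed_simplex ` K)" using that P Qs by blast
    fix s assume s: "s \<in> K"
    have "?supp ` (A \<inter> closed_simplex s) \<subseteq> Pow s" by (auto simp: closed_simplex_def)
    then have "finite (?supp ` (A \<inter> closed_simplex s))" using fin[OF s] finite_subset by blast
    moreover have "inj_on ?supp (A \<inter> closed_simplex s)"
      using that P(2) by (meson Int_lower1 inj_on_subset)
    ultimately have "finite (A \<inter> closed_simplex s)" using finite_imageD by blast
    moreover have "Hausdorff_space (powertop_real (UNIV :: 'a set))"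
      by (simp add: Hausdorff_space_product_topology)
    ultimately show "closedin (powertop_real UNIV) (A \<inter> closed_simplex s)"
      by (intro closedin_Hausdorff_finite) auto
  qed
  have "compactin (realization K) P"
    using closed_compactin[OF Q P(1) cl[OF subset_refl]] .
  moreover have "subtopology (realization K) P = discrete_topology P"
  proof -
    have PT: "P \<subseteq> topspace (realization K)" using P Qs by (auto simp: topspace_realization)
    have "openin (subtopology (realization K) P) {x}" if "x \<in> P" for x
    proof -
      have eq: "{x} = (topspace (realization K) - (P - {x})) \<inter> P" using that PT by blast
      have "openin (realization K) (topspace (realization K) - (P - {x}))"
        using cl[of "P - {x}"] by blast
      then show ?thesis unfolding openin_subtopology using eq by blast
    qed
    moreover have "topspace (subtopology (realization K) P) = P"
      using PT by (rule topspace_subtopology_subset)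
    ultimately show ?thesis using discrete_topology_unique[of P "subtopology (realization K) P"] by simp
  qed
  ultimately have "finite P"
    by (simp add: compactin_subspace compact_space_discrete_topology)
  then have "finite (?supp ` P)" by (rule finite_imageI)
  then show ?thesis unfolding P(3) .
qed

lemma finite_supports_of_path:
  assumes "\<And>s. s \<in> K \<Longrightarrow> finite s" "pathin (realization K) \<beta>"
  shows "finite ((\<lambda>t. {v. \<beta> t v \<noteq> (0::real)}) ` {0..1})"
proof -
  have "compactin (realization K) (\<beta> ` {0..1})"
    using assms(2) unfolding pathin_def
    by (intro image_compactin[of "top_of_set {0..1}"]) (auto simp: compactin_subtopology)
  from finite_supports_of_compact[OF assms(1) this] show ?thesis by (simp add: image_image)
qed

lemma continuous_map_realization_coordinates:
  assumes fin: "\<And>s. s \<in> K \<Longrightarrow> finite s"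
  shows "continuous_map (realization K) (powertop_real UNIV) (\<lambda>b. b)"
  unfolding continuous_map_closedin
proof (intro conjI allI impI)
  fix C :: "('a \<Rightarrow> real) set" assume "closedin (powertop_real UNIV) C"
  have cr: "closedin (realization K) C \<longleftrightarrow> C \<subseteq> \<Union> (closed_simplex ` K) \<and>
    (\<forall>s\<in>K. closedin (powertop_real UNIV) (C \<inter> closed_simplex s))" for C
    by (rule closedin_realization_finite) (rule fin)
  have "closedin (realization K) (\<Union> (closed_simplex ` K) \<inter> C)"
    unfolding cr
  proof (intro conjI ballI)
    fix s assume "s \<in> K"
    then have "\<Union> (closed_simplex ` K) \<inter> C \<inter> closed_simplex s = C \<inter> closed_simplex s" by blast
    with \<open>closedin _ C\<close> show "closedin (powertop_real UNIV) (\<Union> (closed_simplex ` K) \<inter> C \<inter> closed_simplex s)"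
      by (simp add: closedin_Int closedin_closed_simplex fin \<open>s \<in> K\<close>)
  qed auto
  moreover have "{x \<in> topspace (realization K). x \<in> C} = \<Union> (closed_simplex ` K) \<inter> C"
    unfolding topspace_realization by blast
  ultimately show "closedin (realization K) {x \<in> topspace (realization K). x \<in> C}" by simp
qed auto

lemma contiguous_loops_homotopic:
  fixes K :: "'v set set"
  assumes fin: "\<And>s. s \<in> K \<Longrightarrow> finite s"
    and sub: "\<And>s t. s \<in> K \<Longrightarrow> t \<subseteq> s \<Longrightarrow> t \<noteq> {} \<Longrightarrow> t \<in> K"
    and b: "\<beta> \<in> loops_at (realization K) b0" and c: "\<gamma> \<in> loops_at (realization K) b0"
    and cont: "\<And>t. t \<in> {0..1} \<Longrightarrow> \<exists>s\<in>K. \<beta> t \<in> closed_simplex s \<and> \<gamma> t \<in> closed_simplex s"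
  shows "loop_homotopic (realization K) b0 \<beta> \<gamma>"
proof -
  let ?I = "top_of_set {0..1::real}"
  define h where "h = (\<lambda>(u::real, t) v. (1 - u) * \<beta> t v + u * \<gamma> t v)"
  define S where "S = (\<lambda>t. {v. \<beta> t v \<noteq> 0} \<union> {v. \<gamma> t v \<noteq> 0})"
  have pb: "pathin (realization K) \<beta>" and pc: "pathin (realization K) \<gamma>"
    using b c by (auto simp: loops_at_def)
  have "S ` {0..1} \<subseteq> (\<lambda>(A, B). A \<union> B) `
     (((\<lambda>t. {v. \<beta> t v \<noteq> 0}) ` {0..1}) \<times> ((\<lambda>t. {v. \<gamma> t v \<noteq> 0}) ` {0..1}))"
    by (auto simp: S_def)
  then have finS: "finite (S ` {0..1})"
    using finite_supports_of_path[OF fin pb] finite_supports_of_path[OF fin pc]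
    by (meson finite_SigmaI finite_imageI finite_subset)
  have SK: "S t \<in> K \<and> \<beta> t \<in> closed_simplex (S t) \<and> \<gamma> t \<in> closed_simplex (S t)" if t: "t \<in> {0..1}" for t
  proof -
    obtain s where s: "s \<in> K" "\<beta> t \<in> closed_simplex s" "\<gamma> t \<in> closed_simplex s" using cont[OF t] by blast
    then have "S t \<subseteq> s" by (auto simp: S_def closed_simplex_def)
    moreover have "S t \<noteq> {}" using closed_simplex_support_nonempty[OF s(2)] by (auto simp: S_def)
    ultimately have "S t \<in> K" using sub s by blast
    then show ?thesis
      using closed_simplex_support[OF fin[OF s(1)] s(2), of "S t"]
        closed_simplex_support[OF fin[OF s(1)] s(3), of "S t"] fin
      by (auto simp: S_def)
  qed
  have coord: "continuous_map ?I euclideanreal (\<lambda>t. \<delta> t v)" if "pathin (realization K) \<delta>" for \<delta> v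
  proof -
    have "continuous_map ?I (powertop_real UNIV) ((\<lambda>b. b) \<circ> \<delta>)"
      using that unfolding pathin_def
      by (rule continuous_map_compose[OF _ continuous_map_realization_coordinates[OF fin]])
    then show ?thesis by (simp add: continuous_map_componentwise_UNIV o_def)
  qed
  have "continuous_map (prod_topology ?I ?I) (realization K) h"
  proof (rule continuous_map_into_realization[OF fin finS])
    show "S ` {0..1} \<subseteq> K" using SK by blast
    show "continuous_map (prod_topology ?I ?I) (powertop_real UNIV) h"
      unfolding continuous_map_componentwise_UNIV
    proof
      fix v
      have 1: "continuous_map (prod_topology ?I ?I) euclideanreal fst"
        using continuous_map_fst continuous_map_into_fulltopology by blast
      have 2: "continuous_map (prod_topology ?I ?I) euclideanreal (\<lambda>z. \<delta> (snd z) v)"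
        if "pathin (realization K) \<delta>" for \<delta>
        using continuous_map_compose[OF continuous_map_snd coord[OF that]] unfolding o_def .
      show "continuous_map (prod_topology ?I ?I) euclideanreal (\<lambda>z. h z v)"
        unfolding h_def case_prod_unfold
        by (intro continuous_map_add continuous_map_real_mult continuous_map_diff 1 2[OF pb] 2[OF pc]) auto
    qed
    fix z assume "z \<in> topspace (prod_topology ?I ?I)"
    then obtain u t where z: "z = (u, t)" "u \<in> {0..1}" "t \<in> {0..1}" by auto
    have "h z \<in> closed_simplex (S t)"
      using SK[OF z(3)] z(2)
      by (auto simp: z(1) h_def closed_simplex_def sum.distrib sum_distrib_left[symmetric])
    then show "\<exists>s\<in>S ` {0..1}. h z \<in> closed_simplex s" using z(3) by blast
  qed
  moreover have "h (0, t) = \<beta> t" "h (1, t) = \<gamma> t" for t by (auto simp: h_def)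
  moreover have "h (u, t) = b0" if "t = 0 \<or> t = 1" for u t
    using that b c by (auto simp: h_def loops_at_def algebra_simps)
  ultimately show ?thesis
    unfolding loop_homotopic_def homotopic_with_def
    by (intro exI[of _ h]) auto
qed

subsection \<open>Loop classes and induced homomorphisms\<close>

lemma loop_homotopic_refl: "\<alpha> \<in> loops_at X x0 \<Longrightarrow> loop_homotopic X x0 \<alpha> \<alpha>"
  by (simp add: loop_homotopic_def loops_at_def pathin_def)

lemma loop_homotopic_sym: "loop_homotopic X x0 \<alpha> \<beta> \<Longrightarrow> loop_homotopic X x0 \<beta> \<alpha>"
  unfolding loop_homotopic_def by (rule homotopic_with_symD)

lemma loop_homotopic_trans:
  "loop_homotopic X x0 \<alpha> \<beta> \<Longrightarrow> loop_homotopic X x0 \<beta> \<gamma> \<Longrightarrow> loop_homotopic X x0 \<alpha> \<gamma>"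
  unfolding loop_homotopic_def by (rule homotopic_with_trans)

lemma loop_homotopic_imp_loops:
  assumes "loop_homotopic X x0 \<alpha> \<beta>" shows "\<alpha> \<in> loops_at X x0" "\<beta> \<in> loops_at X x0"
  using homotopic_with_imp_continuous_maps[OF assms[unfolded loop_homotopic_def]]
    homotopic_with_imp_property[OF assms[unfolded loop_homotopic_def]]
  by (auto simp: loops_at_def pathin_def)

lemma loop_class_eqI: "loop_homotopic X x0 \<alpha> \<beta> \<Longrightarrow> loop_class X x0 \<alpha> = loop_class X x0 \<beta>"
  unfolding loop_class_def
  by (auto intro: loop_homotopic_trans loop_homotopic_trans[OF loop_homotopic_sym])

lemma loop_class_self: "\<alpha> \<in> loops_at X x0 \<Longrightarrow> \<alpha> \<in> loop_class X x0 \<alpha>"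
  by (simp add: loop_class_def loop_homotopic_refl)

lemma loop_class_eq_iff:
  "\<alpha> \<in> loops_at X x0 \<Longrightarrow> loop_class X x0 \<alpha> = loop_class X x0 \<beta> \<longleftrightarrow> loop_homotopic X x0 \<alpha> \<beta>"
  by (metis loop_class_def loop_class_eqI loop_class_self loop_homotopic_sym mem_Collect_eq)

lemma loop_homotopic_map:
  assumes "continuous_map X Y f" "f x0 = y0" "loop_homotopic X x0 \<alpha> \<beta>"
  shows "loop_homotopic Y y0 (f \<circ> \<alpha>) (f \<circ> \<beta>)"
  using assms unfolding loop_homotopic_def
  by (auto intro!: homotopic_with_compose_continuous_map_left)

lemma loops_at_map:
  assumes "continuous_map X Y f" "f x0 = y0" "\<alpha> \<in> loops_at X x0"
  shows "f \<circ> \<alpha> \<in> loops_at Y y0"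
  using assms by (auto simp: loops_at_def pathin_compose)

lemma pi1_map_loop_class:
  assumes "continuous_map X Y f" "f x0 = y0" "\<alpha> \<in> loops_at X x0"
  shows "pi1_map Y y0 f (loop_class X x0 \<alpha>) = loop_class Y y0 (f \<circ> \<alpha>)"
proof -
  have "loop_class Y y0 (f \<circ> \<beta>) = loop_class Y y0 (f \<circ> \<alpha>)" if "\<beta> \<in> loop_class X x0 \<alpha>" for \<beta>
    using loop_class_eqI[OF loop_homotopic_map[OF assms(1,2)]] that by (auto simp: loop_class_def)
  then show ?thesis
    unfolding pi1_map_def using loop_class_self[OF assms(3)] by blast
qed

lemma loop_homotopic_concat:
  assumes "loop_homotopic X x0 \<alpha> \<alpha>'" "loop_homotopic X x0 \<beta> \<beta>'"
  shows "loop_homotopic X x0 (loop_concat \<alpha> \<beta>) (loop_concat \<alpha>' \<beta>')"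
proof -
  let ?I = "top_of_set {0..1::real}"
  obtain h k where h: "continuous_map (prod_topology ?I ?I) X h" "\<And>t. h (0, t) = \<alpha> t" "\<And>t. h (1, t) = \<alpha>' t"
     "\<And>u. u \<in> {0..1} \<Longrightarrow> h (u, 0) = x0 \<and> h (u, 1) = x0"
    and k: "continuous_map (prod_topology ?I ?I) X k" "\<And>t. k (0, t) = \<beta> t" "\<And>t. k (1, t) = \<beta>' t"
     "\<And>u. u \<in> {0..1} \<Longrightarrow> k (u, 0) = x0 \<and> k (u, 1) = x0"
    using assms unfolding loop_homotopic_def homotopic_with_def by (metis (no_types, lifting))
  define m where "m = (\<lambda>z. if snd z \<le> 1/2 then h (fst z, 2 * snd z) else k (fst z, 2 * snd z - 1))"
  have II: "prod_topology ?I ?I = top_of_set ({0..1} \<times> {0..1})"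
    by (simp add: subtopology_Times[symmetric] euclidean_product_topology)
  have "continuous_map (prod_topology ?I ?I) X m"
    unfolding m_def
  proof (rule continuous_map_cases_le)
    show "continuous_map (prod_topology ?I ?I) euclideanreal snd"
      "continuous_map (prod_topology ?I ?I) euclideanreal (\<lambda>x. 1/2)"
      by (auto simp: II intro!: continuous_intros)
    have "continuous_map (subtopology (prod_topology ?I ?I) {z \<in> topspace (prod_topology ?I ?I). snd z \<le> 1/2})
       (prod_topology ?I ?I) (\<lambda>z. (fst z, 2 * snd z))"
      by (auto simp: II subtopology_subtopology intro!: continuous_intros)
    from continuous_map_compose[OF this h(1)]
    show "continuous_map (subtopology (prod_topology ?I ?I) {z \<in> topspace (prod_topology ?I ?I). snd z \<le> 1/2}) X
       (\<lambda>z. h (fst z, 2 * snd z))" by (simp add: o_def)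
    have "continuous_map (subtopology (prod_topology ?I ?I) {z \<in> topspace (prod_topology ?I ?I). 1/2 \<le> snd z})
       (prod_topology ?I ?I) (\<lambda>z. (fst z, 2 * snd z - 1))"
      by (auto simp: II subtopology_subtopology intro!: continuous_intros)
    from continuous_map_compose[OF this k(1)]
    show "continuous_map (subtopology (prod_topology ?I ?I) {z \<in> topspace (prod_topology ?I ?I). 1/2 \<le> snd z}) X
       (\<lambda>z. k (fst z, 2 * snd z - 1))" by (simp add: o_def)
    fix z assume "z \<in> topspace (prod_topology ?I ?I)" "snd z = 1/2"
    then have "fst z \<in> {0..1}" "2 * snd z = 1" by auto
    then show "h (fst z, 2 * snd z) = k (fst z, 2 * snd z - 1)"
      using h(4) k(4) by simp
  qed
  then show ?thesis
    unfolding loop_homotopic_def homotopic_with_def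
    by (intro exI[of _ m]) (auto simp: m_def loop_concat_def h k)
qed

lemma loop_concat_loops_at:
  "\<alpha> \<in> loops_at X x0 \<Longrightarrow> \<beta> \<in> loops_at X x0 \<Longrightarrow> loop_concat \<alpha> \<beta> \<in> loops_at X x0"
  by (rule loop_homotopic_imp_loops(1)[OF loop_homotopic_concat[OF loop_homotopic_refl loop_homotopic_refl]])

lemma pi1_mult_loop_class:
  assumes "\<alpha> \<in> loops_at X x0" "\<beta> \<in> loops_at X x0"
  shows "loop_class X x0 \<alpha> \<otimes>\<^bsub>pi1 X x0\<^esub> loop_class X x0 \<beta> = loop_class X x0 (loop_concat \<alpha> \<beta>)"
proof -
  have "loop_class X x0 (loop_concat \<alpha>' \<beta>') = loop_class X x0 (loop_concat \<alpha> \<beta>)"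
    if "\<alpha>' \<in> loop_class X x0 \<alpha>" "\<beta>' \<in> loop_class X x0 \<beta>" for \<alpha>' \<beta>'
    using that by (intro loop_class_eqI loop_homotopic_concat loop_homotopic_sym[of X x0 \<alpha>]
        loop_homotopic_sym[of X x0 \<beta>]) (auto simp: loop_class_def)
  then have "(\<Union>\<alpha>'\<in>loop_class X x0 \<alpha>. \<Union>\<beta>'\<in>loop_class X x0 \<beta>. loop_class X x0 (loop_concat \<alpha>' \<beta>'))
      = (\<Union>\<alpha>'\<in>loop_class X x0 \<alpha>. \<Union>\<beta>'\<in>loop_class X x0 \<beta>. loop_class X x0 (loop_concat \<alpha> \<beta>))"
    by (intro SUP_cong refl) blast
  also have "\<dots> = loop_class X x0 (loop_concat \<alpha> \<beta>)"
    using assms[THEN loop_class_self] by blast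
  finally show ?thesis by (simp add: pi1_def)
qed

subsection \<open>Compatibility of the canonical maps\<close>

lemma nerve_simplex: "s \<in> nerve \<U> \<Longrightarrow> finite s"
  "s \<in> nerve \<U> \<Longrightarrow> t \<subseteq> s \<Longrightarrow> t \<noteq> {} \<Longrightarrow> t \<in> nerve \<U>"
proof -
  show "s \<in> nerve \<U> \<Longrightarrow> finite s" by (simp add: nerve_def)
  assume "s \<in> nerve \<U>" "t \<subseteq> s" "t \<noteq> {}"
  moreover have "\<Inter> s \<subseteq> \<Inter> t" using \<open>t \<subseteq> s\<close> by (rule Inter_anti_mono)
  ultimately show "t \<in> nerve \<U>" by (auto simp: nerve_def intro: finite_subset)
qed

lemma canonical_map_support:
  assumes "canonical_map X x0 \<U> p" "x \<in> topspace X" "p x U \<noteq> 0"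
  shows "U \<in> fst \<U>" "x \<in> U"
proof -
  have "p x \<in> topspace (nerve_space \<U>)"
    using assms by (auto simp: canonical_map_def continuous_map_def)
  then obtain s where s: "s \<in> nerve (fst \<U>)" "p x \<in> closed_simplex s"
    by (auto simp: topspace_realization)
  with assms(3) have "U \<in> s" by (auto simp: closed_simplex_def)
  then show U: "U \<in> fst \<U>" using s by (auto simp: nerve_def)
  have "p x U > 0" using s assms(3) by (auto simp: closed_simplex_def less_le)
  then have "p x \<in> open_star (nerve (fst \<U>)) U" using s by (auto simp: open_star_def)
  then show "x \<in> U" using assms(1,2) U by (auto simp: canonical_map_def)
qed

lemma simplicial_map_closed_simplex:
  assumes "finite s" "b \<in> closed_simplex s"
  shows "simplicial_map q b \<in> closed_simplex (q ` s)"
    and "simplicial_map q b w = (\<Sum>v\<in>s. if q v = w then b v else 0)"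
proof -
  have sub: "{v. b v \<noteq> 0} \<subseteq> s" using assms by (auto simp: closed_simplex_def)
  have *: "simplicial_map q b w = (\<Sum>v\<in>s. if q v = w then b v else 0)" for w
  proof -
    have "(\<Sum>v\<in>s. if q v = w then b v else 0) = (\<Sum>v | b v \<noteq> 0 \<and> q v = w. if q v = w then b v else 0)"
      by (rule sum.mono_neutral_right) (use sub assms in \<open>auto split: if_splits\<close>)
    also have "\<dots> = simplicial_map q b w" by (simp add: simplicial_map_def)
    finally show ?thesis by simp
  qed
  then show "simplicial_map q b w = (\<Sum>v\<in>s. if q v = w then b v else 0)" .
  have "(\<Sum>w\<in>q ` s. simplicial_map q b w) = (\<Sum>v\<in>s. \<Sum>w\<in>q ` s. if q v = w then b v else 0)"
    unfolding * by (rule sum.swap)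
  also have "\<dots> = (\<Sum>v\<in>s. b v)" using assms(1) by (intro sum.cong) (auto simp: sum.delta)
  also have "\<dots> = 1" using assms by (simp add: closed_simplex_def)
  finally have "(\<Sum>w\<in>q ` s. simplicial_map q b w) = 1" .
  moreover have "simplicial_map q b w \<ge> 0" for w
    unfolding * using assms by (intro sum_nonneg) (auto simp: closed_simplex_def)
  moreover have "simplicial_map q b w = 0" if "w \<notin> q ` s" for w
    unfolding * using that by (intro sum.neutral) auto
  ultimately show "simplicial_map q b \<in> closed_simplex (q ` s)" by (auto simp: closed_simplex_def)
qed

lemma continuous_map_simplicial_map:
  assumes finK: "\<And>s. s \<in> K \<Longrightarrow> finite s" and finL: "\<And>s. s \<in> L \<Longrightarrow> finite s"
    and q: "\<And>s. s \<in> K \<Longrightarrow> q ` s \<in> L"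
  shows "continuous_map (realization K) (realization L) (simplicial_map q)"
proof -
  have on_simplex: "continuous_map (subtopology (powertop_real UNIV) (closed_simplex s)) (realization L) (simplicial_map q)"
    if s: "s \<in> K" for s
  proof (rule continuous_map_into_realization[of L "{q ` s}", OF finL])
    show "continuous_map (subtopology (powertop_real UNIV) (closed_simplex s)) (powertop_real UNIV) (simplicial_map q)"
      unfolding continuous_map_componentwise_UNIV
    proof
      fix w
      have "continuous_map (subtopology (powertop_real UNIV) (closed_simplex s)) euclideanreal
          (\<lambda>b. \<Sum>v\<in>s. if q v = w then b v else 0)"
      proof (intro continuous_map_sum finK s)
        fix v
        show "continuous_map (subtopology (powertop_real UNIV) (closed_simplex s)) euclideanreal
          (\<lambda>b. if q v = w then b v else 0)"
          by (cases "q v = w") (auto intro!: continuous_intros)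
      qed
      then show "continuous_map (subtopology (powertop_real UNIV) (closed_simplex s)) euclideanreal
          (\<lambda>b. simplicial_map q b w)"
        by (rule continuous_map_eq) (simp add: simplicial_map_closed_simplex(2)[OF finK[OF s]])
    qed
  qed (use q s simplicial_map_closed_simplex(1)[OF finK[OF s]] in auto)
  show ?thesis
    unfolding continuous_map_def
  proof (intro conjI allI impI)
    show img: "simplicial_map q \<in> topspace (realization K) \<rightarrow> topspace (realization L)"
      unfolding topspace_realization using simplicial_map_closed_simplex(1) finK q by fast
    fix W assume W: "openin (realization L) W"
    show "openin (realization K) {b \<in> topspace (realization K). simplicial_map q b \<in> W}"
      unfolding openin_realization
    proof (intro conjI ballI)
      fix s assume s: "s \<in> K"
      have "{b \<in> topspace (realization K). simplicial_map q b \<in> W} \<inter> closed_simplex s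
        = {b \<in> topspace (subtopology (powertop_real UNIV) (closed_simplex s)). simplicial_map q b \<in> W}"
        using s by (auto simp: topspace_realization)
      then show "openin (subtopology (powertop_real UNIV) (closed_simplex s))
         ({b \<in> topspace (realization K). simplicial_map q b \<in> W} \<inter> closed_simplex s)"
        using openin_continuous_map_preimage[OF on_simplex[OF s] W] by simp
    qed (auto simp: topspace_realization)
  qed
qed

lemma bonding_vertex_map_nerve:
  assumes "bonding_vertex_map \<V> \<U> q" "s \<in> nerve (fst \<V>)"
  shows "q ` s \<in> nerve (fst \<U>)"
proof -
  have "\<Inter> s \<subseteq> \<Inter> (q ` s)" using assms by (fastforce simp: nerve_def bonding_vertex_map_def)
  then show ?thesis using assms by (auto simp: nerve_def bonding_vertex_map_def)
qed

lemma simplicial_map_vertex: "simplicial_map q (vertex v) = vertex (q v)"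
proof
  fix w
  have "{u. vertex v u \<noteq> 0 \<and> q u = w} = (if q v = w then {v} else {})" by (auto simp: vertex_def)
  then show "simplicial_map q (vertex v) w = vertex (q v) w"
    by (auto simp: simplicial_map_def vertex_def)
qed

text \<open>For every system of choices the natural map takes values in the inverse limit and is a
  homomorphism.\<close>

theorem natural_hom_in_hom:
  assumes "shape_choice X x0 p q"
  shows "natural_hom X x0 p \<in> hom (pi1 X x0) (shape_group X x0 q)"
proof -
  let ?C = "pointed_covers X x0"
  have can: "continuous_map X (nerve_space \<U>) (p \<U>)" "p \<U> x0 = nerve_base \<U>"
    if "\<U> \<in> ?C" for \<U>
    using assms that by (auto simp: shape_choice_def canonical_map_def)
  have val: "natural_hom X x0 p (loop_class X x0 \<alpha>) =
      (\<lambda>\<U>\<in>?C. loop_class (nerve_space \<U>) (nerve_base \<U>) (p \<U> \<circ> \<alpha>))"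
    if "\<alpha> \<in> loops_at X x0" for \<alpha>
    unfolding natural_hom_def using pi1_map_loop_class[OF can that] by (intro restrict_ext) auto
  show ?thesis
  proof (rule homI)
    fix g assume "g \<in> carrier (pi1 X x0)"
    then obtain \<alpha> where \<alpha>: "\<alpha> \<in> loops_at X x0" "g = loop_class X x0 \<alpha>" by (auto simp: pi1_def)
    have "pi1_map (nerve_space \<U>) (nerve_base \<U>) (simplicial_map (q \<U> \<V>))
        (natural_hom X x0 p g \<V>) = natural_hom X x0 p g \<U>"
      if U: "\<U> \<in> ?C" and V: "\<V> \<in> ?C" and ref: "refines \<V> \<U>" for \<U> \<V>
    proof -
      have bond: "bonding_vertex_map \<V> \<U> (q \<U> \<V>)"
        and cU: "canonical_map X x0 \<U> (p \<U>)" and cV: "canonical_map X x0 \<V> (p \<V>)"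
        using assms U V ref by (auto simp: shape_choice_def)
      let ?q = "simplicial_map (q \<U> \<V>)"
      have cq: "continuous_map (nerve_space \<V>) (nerve_space \<U>) ?q"
        by (rule continuous_map_simplicial_map[OF nerve_simplex(1) nerve_simplex(1)])
          (auto intro: bonding_vertex_map_nerve[OF bond])
      have bq: "?q (nerve_base \<V>) = nerve_base \<U>"
        using bond by (simp add: simplicial_map_vertex bonding_vertex_map_def)
      have lV: "p \<V> \<circ> \<alpha> \<in> loops_at (nerve_space \<V>) (nerve_base \<V>)"
        and lU: "p \<U> \<circ> \<alpha> \<in> loops_at (nerve_space \<U>) (nerve_base \<U>)"
        by (rule loops_at_map[OF can \<alpha>(1)], (fact U V)+)+
      have "loop_homotopic (nerve_space \<U>) (nerve_base \<U>) (?q \<circ> (p \<V> \<circ> \<alpha>)) (p \<U> \<circ> \<alpha>)"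
      proof (rule contiguous_loops_homotopic)
        show "finite s" if "s \<in> nerve (fst \<U>)" for s
          using that by (rule nerve_simplex(1))
        show "t \<in> nerve (fst \<U>)" if "s \<in> nerve (fst \<U>)" "t \<subseteq> s" "t \<noteq> {}" for s t
          using that by (rule nerve_simplex(2))
        show "?q \<circ> (p \<V> \<circ> \<alpha>) \<in> loops_at (nerve_space \<U>) (nerve_base \<U>)"
          by (rule loops_at_map[OF cq bq lV])
        show "p \<U> \<circ> \<alpha> \<in> loops_at (nerve_space \<U>) (nerve_base \<U>)" by (rule lU)
        fix t :: real assume t: "t \<in> {0..1}"
        define x where "x = \<alpha> t"
        have x: "x \<in> topspace X" using \<alpha>(1) t
          by (auto simp: x_def loops_at_def pathin_def continuous_map_def)
        obtain r where r: "r \<in> nerve (fst \<U>)" "p \<U> x \<in> closed_simplex r"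
          using continuous_map_funspace[OF can(1)[OF U]] x unfolding topspace_realization by blast
        obtain r' where r': "r' \<in> nerve (fst \<V>)" "p \<V> x \<in> closed_simplex r'"
          using continuous_map_funspace[OF can(1)[OF V]] x unfolding topspace_realization by blast
        define s where "s = {U. p \<U> x U \<noteq> 0}"
        define s' where "s' = {V. p \<V> x V \<noteq> 0}"
        have "s \<subseteq> r" "s' \<subseteq> r'" using r r' by (auto simp: s_def s'_def closed_simplex_def)
        then have fin: "finite s" "finite s'"
          using r(1) r'(1) nerve_simplex(1) finite_subset by blast+
        have pU: "p \<U> x \<in> closed_simplex s" and pV: "p \<V> x \<in> closed_simplex s'"
          using closed_simplex_support[OF nerve_simplex(1)[OF r(1)] r(2) _ fin(1)]
            closed_simplex_support[OF nerve_simplex(1)[OF r'(1)] r'(2) _ fin(2)]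
          by (auto simp: s_def s'_def)
        have sU: "U \<in> fst \<U> \<and> x \<in> U" if "U \<in> s \<union> q \<U> \<V> ` s'" for U
          using that
        proof
          assume "U \<in> s" then show ?thesis
            using canonical_map_support[OF cU x] by (simp add: s_def)
        next
          assume "U \<in> q \<U> \<V> ` s'"
          then obtain V where V: "U = q \<U> \<V> V" "p \<V> x V \<noteq> 0" by (auto simp: s'_def)
          from canonical_map_support[OF cV x V(2)] bond show ?thesis
            unfolding V(1) bonding_vertex_map_def by blast
        qed
        have "s \<noteq> {}" using closed_simplex_support_nonempty[OF r(2)] by (simp add: s_def)
        have K: "s \<union> q \<U> \<V> ` s' \<in> nerve (fst \<U>)"
        proof -
          have "x \<in> \<Inter> (s \<union> q \<U> \<V> ` s')" "s \<union> q \<U> \<V> ` s' \<subseteq> fst \<U>" using sU by blast+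
          then have "\<Inter> (s \<union> q \<U> \<V> ` s') \<noteq> {}" by (metis empty_iff)
          with \<open>s \<union> _ \<subseteq> fst \<U>\<close> show ?thesis unfolding nerve_def mem_Collect_eq
            using \<open>s \<noteq> {}\<close> fin by (intro conjI) simp_all
        qed
        have "p \<U> x \<in> closed_simplex (s \<union> q \<U> \<V> ` s')"
          by (rule closed_simplex_support[OF fin(1) pU]) (use fin in \<open>auto simp: s_def\<close>)
        moreover have "?q (p \<V> x) \<in> closed_simplex (s \<union> q \<U> \<V> ` s')"
        proof (rule closed_simplex_support)
          show "?q (p \<V> x) \<in> closed_simplex (q \<U> \<V> ` s')"
            by (rule simplicial_map_closed_simplex(1)[OF fin(2) pV])
          then show "{v. ?q (p \<V> x) v \<noteq> 0} \<subseteq> s \<union> q \<U> \<V> ` s'" by (auto simp: closed_simplex_def)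
        qed (use fin in auto)
        ultimately show "\<exists>s\<in>nerve (fst \<U>). (?q \<circ> (p \<V> \<circ> \<alpha>)) t \<in> closed_simplex s
            \<and> (p \<U> \<circ> \<alpha>) t \<in> closed_simplex s"
          using K by (auto simp: x_def)
      qed
      from loop_class_eqI[OF this] show ?thesis
        using U V by (simp add: \<alpha>(2) val[OF \<alpha>(1)] pi1_map_loop_class[OF cq bq lV])
    qed
    moreover have "natural_hom X x0 p g \<in> (\<Pi>\<^sub>E \<U>\<in>?C. carrier (pi1_nerve \<U>))"
      unfolding \<alpha>(2) val[OF \<alpha>(1)] pi1_def using loops_at_map[OF can \<alpha>(1)] by simp
    ultimately show "natural_hom X x0 p g \<in> carrier (shape_group X x0 q)"
      by (simp add: shape_group_def)
  next
    fix g h assume "g \<in> carrier (pi1 X x0)" "h \<in> carrier (pi1 X x0)"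
    then obtain \<alpha> \<beta> where \<alpha>: "\<alpha> \<in> loops_at X x0" "g = loop_class X x0 \<alpha>"
      and \<beta>: "\<beta> \<in> loops_at X x0" "h = loop_class X x0 \<beta>" by (auto simp: pi1_def)
    have "p \<U> \<circ> loop_concat \<alpha> \<beta> = loop_concat (p \<U> \<circ> \<alpha>) (p \<U> \<circ> \<beta>)" for \<U>
      by (auto simp: loop_concat_def)
    then show "natural_hom X x0 p (g \<otimes>\<^bsub>pi1 X x0\<^esub> h) =
        natural_hom X x0 p g \<otimes>\<^bsub>shape_group X x0 q\<^esub> natural_hom X x0 p h"
      using loops_at_map[OF can \<alpha>(1)] loops_at_map[OF can \<beta>(1)]
      by (simp add: \<alpha> \<beta> pi1_mult_loop_class val loop_concat_loops_at shape_group_def cong: restrict_cong)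
  qed
qed

subsection \<open>Existence of the choices\<close>

text \<open>The pointed canonical map of a normal cover exists whenever \<open>x0\<close> can be separated from the
  complement of the designated member by a continuous function.\<close>

lemma canonical_map_exists:
  assumes U: "\<U> \<in> pointed_covers X x0"
    and h: "continuous_map X (top_of_set {0..1}) h" "h x0 = (0::real)"
      "\<And>x. x \<in> topspace X - snd \<U> \<Longrightarrow> h x = 1"
  shows "\<exists>p. canonical_map X x0 \<U> p"
proof -
  obtain \<W> c where \<U>: "\<U> = (\<W>, c)" by (cases \<U>)
  then have c: "c \<in> \<W>" "x0 \<in> c" and oc: "open_cover_of X \<W>"
    and "\<exists>f. subordinated_partition_of_unity X \<W> f"
    using U by (auto simp: pointed_covers_def normal_open_cover_def)
  then obtain f where f: "subordinated_partition_of_unity X \<W> f" by blast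
  have x0: "x0 \<in> topspace X" using c oc by (auto simp: open_cover_of_def)
  have fc: "continuous_map X euclideanreal (f V)" and f01: "\<And>x. x \<in> topspace X \<Longrightarrow> 0 \<le> f V x"
    and fV: "\<And>x. x \<in> topspace X \<Longrightarrow> f V x \<noteq> 0 \<Longrightarrow> x \<in> V" if "V \<in> \<W>" for V
    using f that by (auto simp: subordinated_partition_of_unity_def continuous_map_in_subtopology Pi_iff)
  have lf: "\<exists>N. openin X N \<and> x \<in> N \<and> finite {V\<in>\<W>. \<exists>y\<in>N. f V y \<noteq> 0}"
    and f1: "(\<Sum>V | V \<in> \<W> \<and> f V x \<noteq> 0. f V x) = 1" if "x \<in> topspace X" for x
    using f that by (auto simp: subordinated_partition_of_unity_def)
  have hc: "continuous_map X euclideanreal h" and h01: "\<And>x. x \<in> topspace X \<Longrightarrow> 0 \<le> h x \<and> h x \<le> 1"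
    using h(1) by (auto simp: continuous_map_in_subtopology Pi_iff)
  define p where "p = (\<lambda>x V. if V \<notin> \<W> then 0 else h x * f V x + (if V = c then 1 - h x else 0))"
  have p0: "0 \<le> p x V" if "x \<in> topspace X" for x V
    using that h01 f01 by (auto simp: p_def)
  have pV: "V \<in> \<W> \<and> x \<in> V" if x: "x \<in> topspace X" and "p x V \<noteq> 0" for x V
  proof -
    have V: "V \<in> \<W>" using that by (auto simp: p_def split: if_splits)
    moreover have "x \<in> V"
    proof (rule ccontr)
      assume nx: "x \<notin> V"
      then have "f V x = 0" using fV[OF V x] by blast
      moreover have "h x = 1" if "V = c" using h(3)[of x] x nx that \<U> by auto
      ultimately show False using that(2) by (auto simp: p_def split: if_splits)
    qed
    ultimately show ?thesis ..
  qed
  have psimplex: "p x \<in> closed_simplex s" if x: "x \<in> topspace X" and s: "finite s" "s \<subseteq> \<W>" "c \<in> s"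
      "{V \<in> \<W>. f V x \<noteq> 0} \<subseteq> s" for x s
  proof -
    have "sum (p x) s = (\<Sum>V\<in>s. h x * f V x + (if V = c then 1 - h x else 0))"
      using s by (intro sum.cong) (auto simp: p_def)
    also have "\<dots> = h x * (\<Sum>V\<in>s. f V x) + (1 - h x)"
      using s by (simp add: sum.distrib sum_distrib_left)
    also have "(\<Sum>V\<in>s. f V x) = (\<Sum>V | V \<in> \<W> \<and> f V x \<noteq> 0. f V x)"
      using s by (intro sum.mono_neutral_right) auto
    finally have "sum (p x) s = 1" using f1[OF x] by simp
    moreover have "p x V = 0" if "V \<notin> s" for V
      using that s by (auto simp: p_def)
    ultimately show ?thesis using p0[OF x] by (simp add: closed_simplex_def)
  qed
  have local: "\<exists>N. openin X N \<and> x \<in> N \<and> continuous_map (subtopology X N) (realization (nerve \<W>)) p"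
    if x: "x \<in> topspace X" for x
  proof -
    obtain N where N: "openin X N" "x \<in> N" "finite {V\<in>\<W>. \<exists>y\<in>N. f V y \<noteq> 0}"
      using lf[OF x] by blast
    define T where "T = insert c {V\<in>\<W>. \<exists>y\<in>N. f V y \<noteq> 0}"
    have T: "finite T" "T \<subseteq> \<W>" "c \<in> T" using N c by (auto simp: T_def)
    have "continuous_map (subtopology X N) (realization (nerve \<W>)) p"
    proof (rule continuous_map_into_realization)
      show "finite s" if "s \<in> nerve \<W>" for s using that by (rule nerve_simplex(1))
      show "finite (nerve \<W> \<inter> Pow T)" using T by simp
      show "nerve \<W> \<inter> Pow T \<subseteq> nerve \<W>" by blast
      show "continuous_map (subtopology X N) (powertop_real UNIV) p"
        unfolding continuous_map_componentwise_UNIV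
      proof
        fix V
        have "continuous_map X euclideanreal (\<lambda>x. p x V)"
        proof (cases "V \<in> \<W>")
          case True
          have "continuous_map X euclideanreal (\<lambda>x. if V = c then 1 - h x else 0)"
            using hc by (cases "V = c") (auto intro!: continuous_intros)
          then have "continuous_map X euclideanreal (\<lambda>x. h x * f V x + (if V = c then 1 - h x else 0))"
            by (intro continuous_map_add continuous_map_real_mult hc fc True)
          then show ?thesis using True by (simp add: p_def)
        qed (simp add: p_def)
        then show "continuous_map (subtopology X N) euclideanreal (\<lambda>x. p x V)"
          by (rule continuous_map_from_subtopology)
      qed
      fix y assume "y \<in> topspace (subtopology X N)"
      then have y: "y \<in> topspace X" "y \<in> N" by auto
      define s where "s = {V. p y V \<noteq> 0}"
      have pT: "p y \<in> closed_simplex T" by (rule psimplex[OF y(1) T]) (use y in \<open>auto simp: T_def\<close>)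
      then have "s \<subseteq> T" by (auto simp: s_def closed_simplex_def)
      then have fs: "finite s" using T finite_subset by blast
      have "s \<noteq> {}" using closed_simplex_support_nonempty[OF pT] by (simp add: s_def)
      moreover have "y \<in> \<Inter> s" "s \<subseteq> \<W>" using pV[OF y(1)] by (auto simp: s_def)
      ultimately have "s \<in> nerve \<W>" using fs unfolding nerve_def by blast
      moreover have "p y \<in> closed_simplex s"
        by (rule closed_simplex_support[OF T(1) pT _ fs]) (simp add: s_def)
      ultimately show "\<exists>s\<in>nerve \<W> \<inter> Pow T. p y \<in> closed_simplex s" using \<open>s \<subseteq> T\<close> by blast
    qed
    with N show ?thesis by blast
  qed
  have "continuous_map X (realization (nerve \<W>)) p"
    unfolding continuous_map_def
  proof (intro conjI allI impI)
    show "p \<in> topspace X \<rightarrow> topspace (realization (nerve \<W>))"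
    proof
      fix x assume x: "x \<in> topspace X"
      with local[OF x] show "p x \<in> topspace (realization (nerve \<W>))"
        by (auto simp: continuous_map_def)
    qed
    fix Q assume Q: "openin (realization (nerve \<W>)) Q"
    show "openin X {x \<in> topspace X. p x \<in> Q}"
    proof (subst openin_subopen, intro ballI)
      fix x assume "x \<in> {x \<in> topspace X. p x \<in> Q}"
      then have x: "x \<in> topspace X" "p x \<in> Q" by auto
      obtain N where N: "openin X N" "x \<in> N" "continuous_map (subtopology X N) (realization (nerve \<W>)) p"
        using local[OF x(1)] by blast
      have "openin (subtopology X N) {y \<in> topspace (subtopology X N). p y \<in> Q}"
        using openin_continuous_map_preimage[OF N(3) Q] .
      then have "openin X {y \<in> topspace (subtopology X N). p y \<in> Q}"
        using N(1) openin_trans_full by blast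
      then show "\<exists>T. openin X T \<and> x \<in> T \<and> T \<subseteq> {x \<in> topspace X. p x \<in> Q}"
        using x N(2) by (intro exI[of _ "{y \<in> topspace (subtopology X N). p y \<in> Q}"]) auto
    qed
  qed
  moreover have "p x0 = vertex c"
    using c h(2) by (auto simp: p_def vertex_def)
  moreover have "{x \<in> topspace X. p x \<in> open_star (nerve \<W>) V} \<subseteq> V" for V
    using pV by (force simp: open_star_def)
  ultimately show ?thesis
    unfolding canonical_map_def \<U> by auto
qed

lemma bonding_vertex_map_exists:
  assumes "refines \<V> \<U>" "\<U> \<in> pointed_covers X x0"
  shows "\<exists>q. bonding_vertex_map \<V> \<U> q"
proof -
  obtain q where "\<forall>V \<in> fst \<V>. q V \<in> fst \<U> \<and> V \<subseteq> q V"
    using assms(1) unfolding refines_def by metis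
  then have "bonding_vertex_map \<V> \<U> (q(snd \<V> := snd \<U>))"
    using assms by (auto simp: bonding_vertex_map_def refines_def pointed_covers_def)
  then show ?thesis by blast
qed

lemma shape_choice_exists:
  assumes "\<And>U. openin X U \<Longrightarrow> x0 \<in> U \<Longrightarrow>
    \<exists>h. continuous_map X (top_of_set {0..1}) h \<and> h x0 = (0::real) \<and> (\<forall>x \<in> topspace X - U. h x = 1)"
  shows "\<exists>p q. shape_choice X x0 p q"
proof -
  have "\<exists>p. canonical_map X x0 \<U> p" if U: "\<U> \<in> pointed_covers X x0" for \<U>
  proof -
    have "openin X (snd \<U>)" "x0 \<in> snd \<U>"
      using U by (auto simp: pointed_covers_def normal_open_cover_def open_cover_of_def)
    then obtain h where "continuous_map X (top_of_set {0..1}) h" "h x0 = (0::real)"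
        "\<forall>x \<in> topspace X - snd \<U>. h x = 1" using assms by blast
    then show ?thesis using canonical_map_exists[OF U] by blast
  qed
  then have "canonical_map X x0 \<U> (SOME p. canonical_map X x0 \<U> p)"
    if "\<U> \<in> pointed_covers X x0" for \<U>
    using someI_ex[of "canonical_map X x0 \<U>"] that by simp
  moreover have "bonding_vertex_map \<V> \<U> (SOME q. bonding_vertex_map \<V> \<U> q)"
    if "\<U> \<in> pointed_covers X x0" "refines \<V> \<U>" for \<U> \<V>
    using someI_ex[OF bonding_vertex_map_exists[OF that(2,1)]] .
  ultimately have "shape_choice X x0 (\<lambda>\<U>. SOME p. canonical_map X x0 \<U> p)
      (\<lambda>\<U> \<V>. SOME q. bonding_vertex_map \<V> \<U> q)"
    unfolding shape_choice_def by simp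
  then show ?thesis by (intro exI)
qed

text \<open>In particular the choices exist at every point of a completely regular space.\<close>

corollary shape_choice_exists_completely_regular:
  assumes "completely_regular_space X" "x0 \<in> topspace X"
  shows "\<exists>p q. shape_choice X x0 p q"
proof (rule shape_choice_exists)
  fix U assume "openin X U" "x0 \<in> U"
  then have "closedin X (topspace X - U)" "x0 \<in> topspace X - (topspace X - U)"
    using assms(2) by auto
  then obtain h where "continuous_map X (top_of_set {0..1::real}) h" "h x0 = 0" "h ` (topspace X - U) \<subseteq> {1}"
    using assms(1) unfolding completely_regular_space_def by blast
  then show "\<exists>h. continuous_map X (top_of_set {0..1}) h \<and> h x0 = (0::real) \<and> (\<forall>x \<in> topspace X - U. h x = 1)"
    by blast
qed

end

theory Submission
  imports Defs
begin

text \<open>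
  (1) If a loop lies in the preimage of the open star of the base vertex under a canonical map \<open>p\<close>,
  then \<open>p \<circ> \<alpha>\<close> is contiguous to the constant loop. Hence a class that \<open>\<phi>\<close> detects in a given nerve
  is not represented inside that preimage.

  (2) The line with two origins, based at \<open>-1\<close>, is a counterexample. Real functions do not
  separate the two origins, so every map into a nerve factors through the line and \<open>\<phi>\<close> is trivial;
  near the base point the space is an interval. The loop passing out through one origin and back
  through the other is essential: on a null homotopy \<open>H\<close>, let \<open>\<mu>\<close> be a Urysohn function that is
  \<open>1\<close> where \<open>H\<close> hits the first origin and \<open>-1\<close> where it hits the second. The complex function
  with real part \<open>\<mu>\<close> and imaginary part the position of \<open>H\<close> on the line has no zeros on the square,
  but winds once around \<open>0\<close> along the boundary.
\<close>

section \<open>Injectivity implies homotopically Hausdorff\<close>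

lemma openin_open_star: "openin (realization K) (open_star K v)"
  unfolding openin_realization
proof (intro conjI ballI)
  fix s assume s: "s \<in> K"
  have "continuous_map (subtopology (powertop_real UNIV) (closed_simplex s)) euclideanreal (\<lambda>b. b v)"
    by (auto intro: continuous_map_from_subtopology continuous_map_product_projection)
  from openin_continuous_map_preimage[OF this, of "{0<..}"]
  have "openin (subtopology (powertop_real UNIV) (closed_simplex s)) {b \<in> closed_simplex s. b v > 0}"
    by simp
  moreover have "open_star K v \<inter> closed_simplex s = {b \<in> closed_simplex s. b v > 0}"
    using s by (auto simp: open_star_def)
  ultimately show "openin (subtopology (powertop_real UNIV) (closed_simplex s))
      (open_star K v \<inter> closed_simplex s)"
    by simp
qed (auto simp: open_star_def)

lemma const_loops_at: "x0 \<in> topspace X \<Longrightarrow> (\<lambda>t. x0) \<in> loops_at X x0"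
  by (simp add: loops_at_def pathin_def)

text \<open>A point with positive coordinate at \<open>v\<close> lies in a simplex that has
  \<open>v\<close> as a vertex, and this simplex also contains \<open>vertex v\<close>. So the loop
  is contiguous to the constant one.\<close>

lemma loop_in_open_star_null:
  assumes fin: "\<And>s. s \<in> K \<Longrightarrow> finite s"
    and sub: "\<And>s t. s \<in> K \<Longrightarrow> t \<subseteq> s \<Longrightarrow> t \<noteq> {} \<Longrightarrow> t \<in> K"
    and \<beta>: "\<beta> \<in> loops_at (realization K) (vertex v)"
    and star: "\<And>t. t \<in> {0..1} \<Longrightarrow> \<beta> t \<in> open_star K v"
  shows "loop_homotopic (realization K) (vertex v) \<beta> (\<lambda>t. vertex v)"
proof (rule contiguous_loops_homotopic[OF fin sub \<beta>])
  have "pathin (realization K) \<beta>" "\<beta> 0 = vertex v"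
    using \<beta> by (auto simp: loops_at_def)
  then have "vertex v \<in> topspace (realization K)"
    unfolding pathin_def by (metis atLeastAtMost_iff continuous_map_funspace funcset_mem order_refl
        topspace_euclidean_subtopology zero_le_one)
  then show "(\<lambda>t. vertex v) \<in> loops_at (realization K) (vertex v)"
    by (rule const_loops_at)
  fix t :: real assume "t \<in> {0..1}"
  then obtain s where s: "s \<in> K" "\<beta> t \<in> closed_simplex s" "\<beta> t v > 0"
    using star by (auto simp: open_star_def)
  then have "v \<in> s" by (auto simp: closed_simplex_def)
  then have "vertex v \<in> closed_simplex s"
    using fin[OF s(1)] by (auto simp: closed_simplex_def vertex_def)
  with s show "\<exists>s\<in>K. \<beta> t \<in> closed_simplex s \<and> vertex v \<in> closed_simplex s" by blast
qed auto

lemma natural_hom_loop_class: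
  assumes "shape_choice X x0 p q" "\<alpha> \<in> loops_at X x0"
  shows "natural_hom X x0 p (loop_class X x0 \<alpha>) =
    (\<lambda>\<U>\<in>pointed_covers X x0. loop_class (nerve_space \<U>) (nerve_base \<U>) (p \<U> \<circ> \<alpha>))"
  unfolding natural_hom_def
  using assms by (intro restrict_ext pi1_map_loop_class) (auto simp: shape_choice_def canonical_map_def)

lemma homotopically_Hausdorff_if_inj:
  assumes x0: "x0 \<in> topspace X" and sc: "shape_choice X x0 p q"
    and inj: "inj_on (natural_hom X x0 p) (carrier (pi1 X x0))"
  shows "homotopically_Hausdorff_at X x0"
  unfolding homotopically_Hausdorff_at_def
proof
  fix g assume g: "g \<in> carrier (pi1 X x0) - {\<one>\<^bsub>pi1 X x0\<^esub>}"
  let ?c = "\<lambda>t::real. x0"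
  have c: "?c \<in> loops_at X x0" by (rule const_loops_at[OF x0])
  obtain \<alpha> where \<alpha>: "\<alpha> \<in> loops_at X x0" "g = loop_class X x0 \<alpha>"
    using g by (auto simp: pi1_def)
  \<comment> \<open>Injectivity is applied to \<open>g\<close> and the trivial class. Their images
    differ at some cover \<U>, whose nerve detects \<open>g\<close>.\<close>
  have "natural_hom X x0 p g \<noteq> natural_hom X x0 p (loop_class X x0 ?c)"
    using inj_onD[OF inj, of g "loop_class X x0 ?c"] g c by (auto simp: pi1_def)
  then obtain \<U> where U: "\<U> \<in> pointed_covers X x0"
    and ne: "loop_class (nerve_space \<U>) (nerve_base \<U>) (p \<U> \<circ> \<alpha>)
       \<noteq> loop_class (nerve_space \<U>) (nerve_base \<U>) (p \<U> \<circ> ?c)"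
    unfolding \<alpha>(2) natural_hom_loop_class[OF sc \<alpha>(1)] natural_hom_loop_class[OF sc c]
    by (auto simp: restrict_def fun_eq_iff split: if_splits)
  have can: "continuous_map X (nerve_space \<U>) (p \<U>)" "p \<U> x0 = nerve_base \<U>"
    using sc U by (auto simp: shape_choice_def canonical_map_def)
  let ?St = "open_star (nerve (fst \<U>)) (snd \<U>)"
  \<comment> \<open>Every loop inside this neighbourhood becomes null homotopic in the nerve of
    \<U>, whereas \<open>g\<close> does not.\<close>
  let ?V = "{x \<in> topspace X. p \<U> x \<in> ?St}"
  have "p \<U> x0 \<in> topspace (nerve_space \<U>)" using can(1) x0 by (auto simp: continuous_map_def)
  then have "x0 \<in> ?V" using x0 can(2) by (auto simp: topspace_realization open_star_def vertex_def)
  moreover have "openin X ?V" by (rule openin_continuous_map_preimage[OF can(1) openin_open_star])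
  moreover have "loop_class X x0 \<beta> \<noteq> g" if \<beta>: "\<beta> \<in> loops_at (subtopology X ?V) x0" for \<beta>
  proof
    assume eq: "loop_class X x0 \<beta> = g"
    have \<beta>X: "\<beta> \<in> loops_at X x0" and im: "\<And>t. t \<in> {0..1} \<Longrightarrow> \<beta> t \<in> ?V"
      using \<beta> by (auto simp: loops_at_def pathin_def continuous_map_in_subtopology Pi_iff)
    have "loop_homotopic (nerve_space \<U>) (nerve_base \<U>) (p \<U> \<circ> \<beta>) (\<lambda>t. nerve_base \<U>)"
      by (rule loop_in_open_star_null[OF nerve_simplex loops_at_map[OF can \<beta>X]])
        (use im in auto)
    moreover have "loop_homotopic X x0 \<alpha> \<beta>"
      using loop_class_eq_iff[OF \<alpha>(1), of \<beta>] eq \<alpha>(2) by simp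
    ultimately have "loop_homotopic (nerve_space \<U>) (nerve_base \<U>) (p \<U> \<circ> \<alpha>) (\<lambda>t. nerve_base \<U>)"
      using loop_homotopic_map[OF can] loop_homotopic_trans by metis
    moreover have "p \<U> \<circ> ?c = (\<lambda>t. nerve_base \<U>)" by (rule ext) (simp add: can(2))
    ultimately show False using ne by (metis loop_class_eqI)
  qed
  ultimately show "\<exists>U. openin X U \<and> x0 \<in> U \<and>
      \<not> (\<exists>\<alpha>\<in>loops_at (subtopology X U) x0. loop_class X x0 \<alpha> = g)"
    by blast
qed

section \<open>The line with two origins\<close>

text \<open>The two sheets are glued away from the origin; \<open>real^3\<close> only supplies the points.\<close>

definition sheet :: "bool \<Rightarrow> real \<Rightarrow> real ^ 3"
  where "sheet b t = (if t = 0 \<and> b then axis 2 1 else axis 1 t)"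

text \<open>The final topology for the two sheets, making the space a quotient of two copies of the
  line; it is not the subspace topology of \<open>real ^ 3\<close>.\<close>

definition line_two_origins :: "(real ^ 3) topology"
  where "line_two_origins =
    topology (\<lambda>U. U \<subseteq> (\<Union>b. range (sheet b)) \<and> (\<forall>b. open (sheet b -` U)))"

lemma sheet_nth_1 [simp]: "sheet b t $ 1 = t"
  by (simp add: sheet_def axis_def)

lemma sheet_eq_iff: "sheet b s = sheet c t \<longleftrightarrow> s = t \<and> (s \<noteq> 0 \<or> b = c)"
proof -
  have "sheet True 0 \<noteq> sheet False 0"
    by (simp add: sheet_def axis_def vec_eq_iff)
  moreover have "s = t" if "sheet b s = sheet c t" using sheet_nth_1 that by metis
  moreover have "sheet True t = sheet False t" if "t \<noteq> 0" using that by (simp add: sheet_def)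
  ultimately show ?thesis by (cases b; cases c) metis+
qed

lemma openin_line_two_origins:
  "openin line_two_origins U \<longleftrightarrow> U \<subseteq> (\<Union>b. range (sheet b)) \<and> (\<forall>b. open (sheet b -` U))"
proof -
  have "istopology (\<lambda>U. U \<subseteq> (\<Union>b. range (sheet b)) \<and> (\<forall>b. open (sheet b -` U)))"
    unfolding istopology_def by (auto simp: vimage_Union open_Int)
  then show ?thesis by (simp add: line_two_origins_def topology_inverse')
qed

lemma topspace_line_two_origins: "topspace line_two_origins = (\<Union>b. range (sheet b))"
proof -
  have "sheet b -` (\<Union>b. range (sheet b)) = UNIV" for b by blast
  then have "openin line_two_origins (\<Union>b. range (sheet b))"
    unfolding openin_line_two_origins by simp
  then show ?thesis by (metis openin_line_two_origins openin_subset openin_topspace subset_antisym)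
qed

lemma sheet_in_topspace: "sheet b t \<in> topspace line_two_origins"
  by (auto simp: topspace_line_two_origins)

lemma line_two_origins_cases:
  assumes "x \<in> topspace line_two_origins" obtains b where "x = sheet b (x $ 1)"
  using assms by (auto simp: topspace_line_two_origins)

lemma continuous_map_sheet: "continuous_map euclideanreal line_two_origins (sheet b)"
  by (auto simp: continuous_map_def sheet_in_topspace openin_line_two_origins vimage_def)

text \<open>The universal property of the final topology.\<close>

lemma continuous_map_from_line_two_origins:
  assumes "\<And>b. continuous_map euclideanreal Z (f \<circ> sheet b)"
  shows "continuous_map line_two_origins Z f"
  unfolding continuous_map_def
proof (intro conjI allI impI)
  show "f \<in> topspace line_two_origins \<rightarrow> topspace Z"
    using continuous_map_funspace[OF assms] by (fastforce simp: topspace_line_two_origins)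
  fix W assume W: "openin Z W"
  have "open (sheet b -` {x \<in> topspace line_two_origins. f x \<in> W})" for b
    using openin_continuous_map_preimage[OF assms W, of b]
    by (simp add: sheet_in_topspace vimage_def)
  then show "openin line_two_origins {x \<in> topspace line_two_origins. f x \<in> W}"
    unfolding openin_line_two_origins by (auto simp: topspace_line_two_origins)
qed

lemma continuous_map_position: "continuous_map line_two_origins euclideanreal (\<lambda>x. x $ 1)"
  by (rule continuous_map_from_line_two_origins) (simp add: o_def)

text \<open>The origins have no disjoint neighbourhoods, yet each is a closed point. This supplies
  the closed sets for Urysohn's lemma on the square.\<close>

lemma closedin_origin: "closedin line_two_origins {sheet b 0}"
proof -
  have "sheet c -` (topspace line_two_origins - {sheet b 0}) = (if c = b then - {0} else UNIV)" for c
    by (auto simp: sheet_in_topspace sheet_eq_iff)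
  then have "open (sheet c -` (topspace line_two_origins - {sheet b 0}))" for c by auto
  then have "openin line_two_origins (topspace line_two_origins - {sheet b 0})"
    unfolding openin_line_two_origins by (auto simp: topspace_line_two_origins)
  then show ?thesis by (simp add: closedin_def sheet_in_topspace)
qed

section \<open>Triviality of the natural homomorphism\<close>

text \<open>Away from 0 the sheets coincide, so the values at both origins are limits of the same
  function as the position tends to 0, and real limits are unique.\<close>

lemma real_map_identifies_sheets:
  fixes f :: "real ^ 3 \<Rightarrow> real"
  assumes "continuous_map line_two_origins euclideanreal f"
  shows "f (sheet b t) = f (sheet c t)"
proof (cases "t = 0")
  case True
  have lim: "((\<lambda>s. f (sheet b s)) \<longlongrightarrow> f (sheet b 0)) (at 0)" for b
    using continuous_map_compose[OF continuous_map_sheet assms, of b]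
    by (auto simp: o_def continuous_on_eq_continuous_at isCont_def)
  have "((\<lambda>s. f (sheet b s)) \<longlongrightarrow> f (sheet c 0)) (at 0)"
    by (rule Lim_transform_eventually[OF lim])
      (auto simp: eventually_at_filter sheet_eq_iff intro!: always_eventually arg_cong[where f = f])
  then show ?thesis using lim tendsto_unique[OF at_neq_bot] True by blast
next
  case False
  then show ?thesis by (metis sheet_eq_iff)
qed

lemma real_loop_null:
  assumes "\<beta> \<in> loops_at euclideanreal r"
  shows "loop_homotopic euclideanreal r \<beta> (\<lambda>t. r)"
proof -
  let ?h = "\<lambda>z::real \<times> real. (1 - fst z) * \<beta> (snd z) + fst z * r"
  have \<beta>: "continuous_on {0..1} \<beta>" "\<beta> 0 = r" "\<beta> 1 = r"
    using assms by (auto simp: loops_at_def pathin_def)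
  have II: "prod_topology (top_of_set {0..1::real}) (top_of_set {0..1::real}) = top_of_set ({0..1} \<times> {0..1})"
    by (simp add: subtopology_Times[symmetric] euclidean_product_topology)
  have "continuous_on ({0..1} \<times> {0..1}) ?h"
    by (intro continuous_intros continuous_on_compose2[OF \<beta>(1)]) auto
  then show ?thesis
    unfolding loop_homotopic_def homotopic_with_def
    by (intro exI[of _ ?h]) (auto simp: II \<beta> algebra_simps)
qed

lemma loop_homotopic_cong:
  assumes "\<alpha> \<in> loops_at X x0" "\<And>t. t \<in> {0..1} \<Longrightarrow> \<alpha> t = \<beta> t"
  shows "loop_homotopic X x0 \<alpha> \<beta>"
  unfolding loop_homotopic_def
  by (rule homotopic_with_equal) (use assms in \<open>auto simp: loops_at_def pathin_def\<close>)

text \<open>The positions of \<alpha> form a loop in the real line; it contracts, and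
  \<open>k\<close> carries the contraction to \<open>Y\<close>. It serves twice: with
  \<open>k\<close> a canonical map restricted to a sheet, and with \<open>k\<close> a sheet
  itself.\<close>

lemma loop_null_if_factors_through_line:
  assumes \<alpha>: "\<alpha> \<in> loops_at line_two_origins (sheet b r)"
    and k: "continuous_map euclideanreal Y k"
    and \<gamma>: "\<And>t. t \<in> {0..1} \<Longrightarrow> \<gamma> t = k (\<alpha> t $ 1)"
  shows "loop_homotopic Y (k r) \<gamma> (\<lambda>t. k r)"
proof -
  have l: "(\<lambda>x. x $ 1) \<circ> \<alpha> \<in> loops_at euclideanreal r"
    by (rule loops_at_map[OF continuous_map_position _ \<alpha>]) simp
  have null: "loop_homotopic Y (k r) (k \<circ> ((\<lambda>x. x $ 1) \<circ> \<alpha>)) (k \<circ> (\<lambda>t. r))"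
    by (rule loop_homotopic_map[OF k refl real_loop_null[OF l]])
  have "loop_homotopic Y (k r) (k \<circ> ((\<lambda>x. x $ 1) \<circ> \<alpha>)) \<gamma>"
    by (rule loop_homotopic_cong[OF loop_homotopic_imp_loops(1)[OF null]]) (simp add: \<gamma>)
  then show ?thesis
    using loop_homotopic_trans[OF loop_homotopic_sym null] by (simp add: o_def)
qed

text \<open>A point of the realization is determined by its barycentric coordinates, and these are
  continuous real functions.\<close>

lemma map_to_realization_identifies_sheets:
  assumes fin: "\<And>s. s \<in> K \<Longrightarrow> finite s"
    and f: "continuous_map line_two_origins (realization K) f"
  shows "f (sheet b t) = f (sheet c t)"
proof
  fix v
  have "continuous_map line_two_origins (powertop_real UNIV) f"
    using continuous_map_compose[OF f continuous_map_realization_coordinates[OF fin]]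
    by (simp add: o_def)
  then have "continuous_map line_two_origins euclideanreal (\<lambda>x. f x v)"
    by (simp add: continuous_map_componentwise_UNIV)
  from real_map_identifies_sheets[OF this] show "f (sheet b t) v = f (sheet c t) v" .
qed

lemma natural_hom_line_two_origins_trivial:
  assumes sc: "shape_choice line_two_origins (sheet b r) p q"
    and \<alpha>: "\<alpha> \<in> loops_at line_two_origins (sheet b r)"
  shows "natural_hom line_two_origins (sheet b r) p (loop_class line_two_origins (sheet b r) \<alpha>) =
    natural_hom line_two_origins (sheet b r) p (loop_class line_two_origins (sheet b r) (\<lambda>t. sheet b r))"
  unfolding natural_hom_loop_class[OF sc \<alpha>]
    natural_hom_loop_class[OF sc const_loops_at[OF sheet_in_topspace]]
proof (rule restrict_ext, rule loop_class_eqI)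
  fix \<U> assume "\<U> \<in> pointed_covers line_two_origins (sheet b r)"
  then have p: "continuous_map line_two_origins (nerve_space \<U>) (p \<U>)"
    and base: "p \<U> (sheet b r) = nerve_base \<U>"
    using sc by (auto simp: shape_choice_def canonical_map_def)
  \<comment> \<open>The factor on the line is the restriction of \<open>p \<U>\<close> to the sheet
    \<open>b\<close>; since \<open>p \<U>\<close> identifies the sheets, it recovers
    \<open>p \<U>\<close> from the position alone.\<close>
  have "loop_homotopic (nerve_space \<U>) ((p \<U> \<circ> sheet b) r) (p \<U> \<circ> \<alpha>) (\<lambda>t. (p \<U> \<circ> sheet b) r)"
  proof (rule loop_null_if_factors_through_line[OF \<alpha> continuous_map_compose[OF continuous_map_sheet p]])
    fix t :: real assume "t \<in> {0..1}"
    then have "\<alpha> t \<in> topspace line_two_origins"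
      using \<alpha> by (auto simp: loops_at_def pathin_def continuous_map_def)
    then obtain c where "\<alpha> t = sheet c (\<alpha> t $ 1)" by (rule line_two_origins_cases)
    then have "p \<U> (\<alpha> t) = p \<U> (sheet c (\<alpha> t $ 1))" by (rule arg_cong)
    also have "\<dots> = p \<U> (sheet b (\<alpha> t $ 1))"
      by (rule map_to_realization_identifies_sheets[OF nerve_simplex(1) p])
    finally show "(p \<U> \<circ> \<alpha>) t = (p \<U> \<circ> sheet b) (\<alpha> t $ 1)" by (simp only: comp_apply)
  qed
  then show "loop_homotopic (nerve_space \<U>) (nerve_base \<U>) (p \<U> \<circ> \<alpha>) (p \<U> \<circ> (\<lambda>t. sheet b r))"
    by (simp add: base o_def)
qed

section \<open>Local behaviour at the base point\<close>

lemma homotopically_Hausdorff_line_two_origins: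
  assumes "r < 0"
  shows "homotopically_Hausdorff_at line_two_origins (sheet b r)"
  unfolding homotopically_Hausdorff_at_def
proof
  fix g assume g: "g \<in> carrier (pi1 line_two_origins (sheet b r)) - {\<one>\<^bsub>pi1 line_two_origins (sheet b r)\<^esub>}"
  \<comment> \<open>One neighbourhood works for every \<open>g\<close>: at negative positions the
    sheets agree, so a loop there is recovered from its position by \<open>sheet b\<close> and is
    null homotopic.\<close>
  let ?U = "{x \<in> topspace line_two_origins. x $ 1 \<in> {..<0}}"
  have "openin line_two_origins ?U"
    by (rule openin_continuous_map_preimage[OF continuous_map_position]) simp
  moreover have "loop_class line_two_origins (sheet b r) \<alpha> \<noteq> g"
    if \<alpha>: "\<alpha> \<in> loops_at (subtopology line_two_origins ?U) (sheet b r)" for \<alpha>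
  proof -
    have \<alpha>X: "\<alpha> \<in> loops_at line_two_origins (sheet b r)"
      and im: "\<And>t. t \<in> {0..1} \<Longrightarrow> \<alpha> t \<in> ?U"
      using \<alpha> by (auto simp: loops_at_def pathin_def continuous_map_in_subtopology Pi_iff)
    have "\<alpha> t = sheet b (\<alpha> t $ 1)" if "t \<in> {0..1}" for t
    proof -
      have "\<alpha> t \<in> topspace line_two_origins" "\<alpha> t $ 1 \<noteq> 0" using im[OF that] by auto
      then show ?thesis by (metis line_two_origins_cases sheet_eq_iff)
    qed
    from loop_null_if_factors_through_line[OF \<alpha>X continuous_map_sheet this]
    have "loop_class line_two_origins (sheet b r) \<alpha> = loop_class line_two_origins (sheet b r) (\<lambda>t. sheet b r)"
      by (rule loop_class_eqI)
    then show ?thesis using g by (auto simp: pi1_def)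
  qed
  ultimately show "\<exists>U. openin line_two_origins U \<and> sheet b r \<in> U \<and>
      \<not> (\<exists>\<alpha>\<in>loops_at (subtopology line_two_origins U) (sheet b r). loop_class line_two_origins (sheet b r) \<alpha> = g)"
    using assms by (intro exI[of _ ?U]) (auto simp: sheet_in_topspace)
qed

text \<open>The space is not completely regular at the origins, but the choices only require functions
  separating the base point from closed sets.\<close>

lemma shape_choice_line_two_origins:
  assumes "r \<noteq> 0"
  shows "\<exists>p q. shape_choice line_two_origins (sheet b r) p q"
proof (rule shape_choice_exists)
  fix U assume U: "openin line_two_origins U" "sheet b r \<in> U"
  \<comment> \<open>Excluding 0 makes the position determine the point throughout the ball chosen
    next.\<close>
  have "open (sheet b -` U \<inter> - {0})"
    using U(1) by (intro open_Int) (auto simp: openin_line_two_origins)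
  then obtain d where d: "d > 0" "ball r d \<subseteq> sheet b -` U \<inter> - {0}"
    using U(2) assms openE[of "sheet b -` U \<inter> - {0}" r] by auto
  \<comment> \<open>The distance of positions from \<open>r\<close>, scaled and truncated to reach 1
    exactly at radius \<open>d\<close>.\<close>
  let ?h = "\<lambda>x::real ^ 3. min 1 (\<bar>x $ 1 - r\<bar> / d)"
  have "continuous_map line_two_origins euclideanreal ?h"
    by (rule continuous_map_from_line_two_origins) (use d in \<open>auto simp: o_def intro!: continuous_intros\<close>)
  then have "continuous_map line_two_origins (top_of_set {0..1}) ?h"
    using d by (auto simp: continuous_map_in_subtopology)
  moreover have "?h x = 1" if x: "x \<in> topspace line_two_origins - U" for x
  proof (rule ccontr)
    assume "?h x \<noteq> 1"
    then have "x $ 1 \<in> ball r d" using d by (auto simp: dist_real_def min_def field_simps split: if_splits)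
    then have "sheet b (x $ 1) \<in> U" "x $ 1 \<noteq> 0" using d by auto
    moreover obtain c where "x = sheet c (x $ 1)" using x line_two_origins_cases by blast
    ultimately have "x \<in> U" by (metis sheet_eq_iff)
    then show False using x by simp
  qed
  ultimately show "\<exists>h. continuous_map line_two_origins (top_of_set {0..1}) h \<and> h (sheet b r) = (0::real) \<and>
      (\<forall>x\<in>topspace line_two_origins - U. h x = 1)"
    by (intro exI[of _ ?h]) auto
qed

section \<open>An essential loop\<close>

text \<open>The position climbs from -1 to 1 and returns. It vanishes at \<open>t = 1/4\<close> on
  the sheet \<open>False\<close> and at \<open>t = 3/4\<close> on the sheet \<open>True\<close>; the
  sheets are switched at position 1, where they agree.\<close>

definition origins_loop :: "real \<Rightarrow> real ^ 3"
  where "origins_loop t = sheet (t > 1/2) (1 - \<bar>4 * t - 2\<bar>)"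

lemma origins_loop_in_loops_at: "origins_loop \<in> loops_at line_two_origins (sheet False (-1))"
proof -
  let ?c = "\<lambda>t::real. 1 - \<bar>4 * t - 2\<bar>" and ?I = "top_of_set {0..1::real}"
  have "continuous_map ?I euclideanreal ?c"
    by (auto intro!: continuous_intros)
  from continuous_map_compose[OF this continuous_map_sheet]
  have c: "continuous_map ?I line_two_origins (\<lambda>t. sheet b (?c t))" for b
    by (simp add: o_def)
  have "continuous_map ?I line_two_origins (\<lambda>t. if t \<le> 1/2 then sheet False (?c t) else sheet True (?c t))"
  proof (rule continuous_map_cases_le)
    show "continuous_map (subtopology ?I {t \<in> topspace ?I. t \<le> 1/2}) line_two_origins (\<lambda>t. sheet False (?c t))"
      "continuous_map (subtopology ?I {t \<in> topspace ?I. 1/2 \<le> t}) line_two_origins (\<lambda>t. sheet True (?c t))"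
      by (rule continuous_map_from_subtopology[OF c])+
    fix t :: real assume "t = 1/2"
    then show "sheet False (?c t) = sheet True (?c t)" by (simp add: sheet_eq_iff)
  qed auto
  moreover have "(\<lambda>t. if t \<le> 1/2 then sheet False (?c t) else sheet True (?c t)) = origins_loop"
    by (auto simp: origins_loop_def)
  ultimately have "pathin line_two_origins origins_loop" by (simp add: pathin_def)
  then show ?thesis
    by (simp add: loops_at_def origins_loop_def sheet_eq_iff)
qed

text \<open>The difference of the two logarithms is continuous and its exponential is constantly
  \<open>1 / c\<close>, so its values are discrete and it is constant on a connected set. The factor
  \<open>c\<close> rotates \<open>F\<close> off the branch cut of \<open>Ln\<close>.\<close>

lemma log_minus_Ln_constant:
  fixes G F :: "'a::topological_space \<Rightarrow> complex"
  assumes A: "connected A" and G: "continuous_on A G" and F: "\<And>z. z \<in> A \<Longrightarrow> F z = exp (G z)"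
    and c: "c \<noteq> 0" and off: "\<And>z. z \<in> A \<Longrightarrow> c * F z \<notin> \<real>\<^sub>\<le>\<^sub>0"
    and z: "z \<in> A" "w \<in> A"
  shows "G z - Ln (c * F z) = G w - Ln (c * F w)"
proof -
  let ?D = "\<lambda>z. G z - Ln (c * F z)"
  have "continuous_on A (\<lambda>z. exp (G z))" using G by (intro continuous_intros)
  then have "continuous_on A F" using F by (simp cong: continuous_on_cong)
  then have cD: "continuous_on A ?D" using G off by (intro continuous_intros)
  have "exp (?D z) = 1 / c" if "z \<in> A" for z
    using that F c by (simp add: exp_diff)
  \<comment> \<open>Distinct complex numbers with equal exponentials have imaginary parts at least
    \<open>2 * pi\<close> apart.\<close>
  then have gap: "2 * pi \<le> norm (?D y - ?D x)" if "x \<in> A" "y \<in> A" "?D y \<noteq> ?D x" for x y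
  proof -
    have "\<not> \<bar>Im (?D y) - Im (?D x)\<bar> < 2 * pi"
      using exp_complex_eqI[of "?D y" "?D x"] that \<open>\<And>z. z \<in> A \<Longrightarrow> exp (?D z) = 1 / c\<close> by auto
    then show ?thesis using abs_Im_le_cmod[of "?D y - ?D x"] by simp
  qed
  have "?D constant_on A"
    by (rule continuous_discrete_range_constant[OF A cD])
      (use gap in \<open>auto intro!: exI[of _ "2 * pi"]\<close>)
  then show ?thesis using z by (auto simp: constant_on_def)
qed

lemma origins_loop_essential:
  "\<not> loop_homotopic line_two_origins (sheet False (-1)) origins_loop (\<lambda>t. sheet False (-1))"
proof
  let ?S = "{0..1::real} \<times> {0..1::real}"
  assume "loop_homotopic line_two_origins (sheet False (-1)) origins_loop (\<lambda>t. sheet False (-1))"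
  then obtain H where "continuous_map (prod_topology (top_of_set {0..1::real}) (top_of_set {0..1::real}))
        line_two_origins H"
    and H0: "\<And>t. H (0, t) = origins_loop t" and H1: "\<And>t. H (1, t) = sheet False (-1)"
    and Hb: "\<And>u. u \<in> {0..1} \<Longrightarrow> H (u, 0) = sheet False (-1) \<and> H (u, 1) = sheet False (-1)"
    unfolding loop_homotopic_def homotopic_with_def by (metis (no_types, lifting))
  then have H: "continuous_map (top_of_set ?S) line_two_origins H"
    by (simp add: subtopology_Times[symmetric] euclidean_product_topology)
  let ?pos = "\<lambda>z. H z $ 1"
  have pos: "continuous_on ?S ?pos"
    using continuous_map_compose[OF H continuous_map_position] by (simp add: o_def)
  have cl: "closedin (top_of_set ?S) {z \<in> ?S. H z = sheet b 0}" for b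
    using closedin_continuous_map_preimage[OF H closedin_origin[of b]] by simp
  obtain \<mu> :: "real \<times> real \<Rightarrow> real" where \<mu>: "continuous_on ?S \<mu>"
      "\<And>z. z \<in> {z \<in> ?S. H z = sheet False 0} \<Longrightarrow> \<mu> z = 1"
      "\<And>z. z \<in> {z \<in> ?S. H z = sheet True 0} \<Longrightarrow> \<mu> z = -1"
    by (rule Urysohn_local[OF cl[of False] cl[of True], of 1 "-1"]) (auto simp: sheet_eq_iff)
  define F where "F = (\<lambda>z. Complex (\<mu> z) (?pos z))"
  \<comment> \<open>At a zero of \<open>F\<close> the position would be 0, so \<open>H\<close> would
    be at an origin, where \<mu> is 1 or -1.\<close>
  have F0: "F z \<noteq> 0" if z: "z \<in> ?S" for z
  proof
    assume "F z = 0"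
    then have "\<mu> z = 0" "?pos z = 0" by (auto simp: F_def complex_eq_iff)
    have "H z \<in> topspace line_two_origins" using H z by (auto simp: continuous_map_def)
    then obtain b where "H z = sheet b (?pos z)" by (rule line_two_origins_cases)
    then have "H z = sheet b 0" unfolding \<open>?pos z = 0\<close> .
    then show False using \<mu>(2,3)[of z] z \<open>\<mu> z = 0\<close> by (cases b) auto
  qed
  have cF: "continuous_on ?S F"
    unfolding F_def by (rule continuous_on_Complex[OF \<mu>(1) pos])
  \<comment> \<open>As the square is contractible, \<open>F\<close> has a logarithm on all of it;
    the winding along the boundary will contradict this.\<close>
  have "contractible ?S" by (intro convex_imp_contractible convex_Times) auto
  then obtain G where G: "continuous_on ?S G" "\<And>z. z \<in> ?S \<Longrightarrow> F z = exp (G z)"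
    using continuous_logarithm_on_contractible[OF cF] F0 by metis
  have "H (0, 1/4) = sheet False 0" "H (0, 3/4) = sheet True 0"
    by (auto simp: H0 origins_loop_def)
  then have F14: "F (0, 1/4) = 1" and F34: "F (0, 3/4) = -1"
    using \<mu>(2)[of "(0, 1/4)"] \<mu>(3)[of "(0, 3/4)"] by (auto simp: F_def complex_eq_iff)
  \<comment> \<open>Multiplying by \<open>- \<i>\<close> or \<open>\<i>\<close> makes the real part
    the position or its negative. Under the stated sign it is nonnegative, so only a zero of
    \<open>F\<close> could meet the cut.\<close>
  have off: "c * F z \<notin> \<real>\<^sub>\<le>\<^sub>0" if "z \<in> ?S" "c = - \<i> \<and> ?pos z \<ge> 0 \<or> c = \<i> \<and> ?pos z \<le> 0" for c z
    using F0[OF that(1)] that(2) by (auto simp: F_def complex_nonpos_Reals_iff complex_eq_iff)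
  have logs: "Ln \<i> = \<i> * pi / 2" "Ln (- \<i>) = - \<i> * pi / 2" by simp_all
  \<comment> \<open>Two arcs of the boundary from \<open>(0, 1/4)\<close> to
    \<open>(0, 3/4)\<close>. On \<open>?P\<close> the loop has nonnegative position; on
    \<open>?Q\<close>, the rest of the boundary, positions are nonpositive.\<close>
  let ?P = "{0::real} \<times> {1/4..3/4::real}"
  let ?Q = "{0::real} \<times> {0..1/4::real} \<union> {0..1} \<times> {0} \<union> {1} \<times> {0..1} \<union> {0..1} \<times> {1} \<union> {0} \<times> {3/4..1}"
  have "?P \<subseteq> ?S" "?Q \<subseteq> ?S" by auto
  have "G (0, 1/4) - Ln (- \<i> * F (0, 1/4)) = G (0, 3/4) - Ln (- \<i> * F (0, 3/4))"
  proof (rule log_minus_Ln_constant[of ?P])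
    show "connected ?P" by (intro connected_Times) auto
    show "continuous_on ?P G" by (rule continuous_on_subset[OF G(1) \<open>?P \<subseteq> ?S\<close>])
    show "F z = exp (G z)" if "z \<in> ?P" for z using G(2) that \<open>?P \<subseteq> ?S\<close> by blast
    show "- \<i> * F z \<notin> \<real>\<^sub>\<le>\<^sub>0" if "z \<in> ?P" for z
      by (rule off) (use that \<open>?P \<subseteq> ?S\<close> in \<open>auto simp: H0 origins_loop_def abs_if\<close>)
  qed auto
  moreover have "G (0, 1/4) - Ln (\<i> * F (0, 1/4)) = G (0, 3/4) - Ln (\<i> * F (0, 3/4))"
  proof (rule log_minus_Ln_constant[of ?Q])
    have Un: "connected (A \<union> B)" if "connected A" "connected B" "z \<in> A" "z \<in> B"
      for A B :: "(real \<times> real) set" and z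
      using that by (intro connected_Un) auto
    \<comment> \<open>The five segments are joined successively at the corners of the
      square.\<close>
    show "connected ?Q"
      by (rule Un[of _ _ "(0, 1)"], rule Un[of _ _ "(1, 1)"], rule Un[of _ _ "(1, 0)"],
          rule Un[of _ _ "(0, 0)"]; (rule connected_Times)?; simp)
    show "continuous_on ?Q G" by (rule continuous_on_subset[OF G(1) \<open>?Q \<subseteq> ?S\<close>])
    show "F z = exp (G z)" if "z \<in> ?Q" for z using G(2) that \<open>?Q \<subseteq> ?S\<close> by blast
    show "\<i> * F z \<notin> \<real>\<^sub>\<le>\<^sub>0" if "z \<in> ?Q" for z
      by (rule off) (use that \<open>?Q \<subseteq> ?S\<close> in \<open>auto simp: H0 H1 Hb origins_loop_def abs_if\<close>)
  qed auto
  \<comment> \<open>From \<open>(0, 1/4)\<close> to \<open>(0, 3/4)\<close> the logarithm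
    \<open>G\<close> changes by \<open>\<i> * pi\<close> along \<open>?P\<close> but by
    \<open>- \<i> * pi\<close> along \<open>?Q\<close>.\<close>
  ultimately have "Ln (- \<i>) - Ln \<i> = Ln \<i> - Ln (- \<i>)"
    by (simp add: F14 F34 algebra_simps)
  then show False by (simp add: logs)
qed

text \<open>In the first half injectivity for a single system of choices suffices; in the second it
  fails for every system, and the existence of one keeps that claim from being vacuous.\<close>

theorem proposition8:
  shows "(\<forall>(X :: 'a topology) x0 p q.
            x0 \<in> topspace X \<longrightarrow> shape_choice X x0 p q \<longrightarrow>
            natural_hom X x0 p \<in> mon (pi1 X x0) (shape_group X x0 q) \<longrightarrow>
            homotopically_Hausdorff_at X x0)
       \<and> (\<exists>(X :: (real ^ 3) topology) x0.
            x0 \<in> topspace X \<and> homotopically_Hausdorff_at X x0 \<and>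
            (\<exists>p q. shape_choice X x0 p q) \<and>
            (\<forall>p q. shape_choice X x0 p q \<longrightarrow>
               natural_hom X x0 p \<in> hom (pi1 X x0) (shape_group X x0 q) \<and>
               \<not> inj_on (natural_hom X x0 p) (carrier (pi1 X x0))))"
proof (intro conjI exI allI impI)
  fix X :: "'a topology" and x0 p q
  assume "x0 \<in> topspace X" "shape_choice X x0 p q"
    "natural_hom X x0 p \<in> mon (pi1 X x0) (shape_group X x0 q)"
  then show "homotopically_Hausdorff_at X x0"
    by (intro homotopically_Hausdorff_if_inj) (auto simp: mon_def)
next
  let ?X = line_two_origins and ?x0 = "sheet False (-1)"
  show "?x0 \<in> topspace ?X" by (rule sheet_in_topspace)
  show "homotopically_Hausdorff_at ?X ?x0"
    by (rule homotopically_Hausdorff_line_two_origins) simp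
  from shape_choice_line_two_origins[of "-1" False]
  show "shape_choice ?X ?x0 (SOME p. \<exists>q. shape_choice ?X ?x0 p q)
      (SOME q. shape_choice ?X ?x0 (SOME p. \<exists>q. shape_choice ?X ?x0 p q) q)"
    by (metis (mono_tags, lifting) someI_ex zero_neq_neg_one)
  fix p q assume sc: "shape_choice ?X ?x0 p q"
  then show "natural_hom ?X ?x0 p \<in> hom (pi1 ?X ?x0) (shape_group ?X ?x0 q)"
    by (rule natural_hom_in_hom)
  show "\<not> inj_on (natural_hom ?X ?x0 p) (carrier (pi1 ?X ?x0))"
  proof
    assume "inj_on (natural_hom ?X ?x0 p) (carrier (pi1 ?X ?x0))"
    \<comment> \<open>The essential loop and the constant loop have the same image, so injectivity
      would make them homotopic.\<close>
    from inj_onD[OF this natural_hom_line_two_origins_trivial[OF sc origins_loop_in_loops_at]]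
    have "loop_class ?X ?x0 origins_loop = loop_class ?X ?x0 (\<lambda>t. ?x0)"
      using origins_loop_in_loops_at const_loops_at[OF sheet_in_topspace] by (auto simp: pi1_def)
    then show False
      using origins_loop_essential loop_class_eq_iff[OF origins_loop_in_loops_at] by blast
  qed
qed

end
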